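(* Any two Schur covers of a finite skew brace are isoclinic.
   Context: A skew brace is a triple $(A,+,\circ)$ where $(A,+)$ and $(A,\circ)$ are (not necessarily abelian) groups with $a\circ(b+c)=a\circ b-a+a\circ c$ for all $a,b,c\in A$. Both groups have the same neutral element $0$. Homomorphisms of skew braces preserve both operations. An abelian group is regarded as a (trivial) skew brace with both operations equal to the group operation. The annihilator of a skew brace $A$ is $\mathrm{Ann}(A)=\{a\in A: -a+a\circ b=b\ \forall b\in A\}\cap Z(A,+)\cap Z(A,\circ)$ (an ideal). Write $[a,b]_+=a+b-a-b$ and $a*b=-a+a\circ b-b$. The commutator $A'$ is the additive subgroup of $A$ generated by all $[a,b]_+$ and all $a*b$ (an ideal). Isoclinism: for a skew brace $B$ there are well-defined maps $\phi^B_+,\phi^B_*:(B/\mathrm{Ann}(B))^2\to B'$, $\phi^B_+(\overline a,\overline b)=[a,b]_+$, $\phi^B_*(\overline a,\overline b)=a*b$. Skew braces $A$ and $B$ are isoclinic if there are skew brace isomorphisms $\xi:A/\mathrm{Ann}(A)\to B/\mathrm{Ann}(B)$ and $\theta:A'\to B'$ with $\theta\phi^A_+=\phi^B_+(\xi\times\xi)$ and $\theta\phi^A_*=\phi^B_*(\xi\times\xi)$. An annihilator extension of $Q$ by an abelian group $K$ is a short exact sequence of skew braces $0\to K\to E\to Q\to0$ with the image of $K$ (identified with $K$) contained in $\mathrm{Ann}(E)$. A Schur cover of a finite skew brace $Q$ is a skew brace $E$ for which there exists an annihilator extension $0\to K\to E\to Q\to0$ with $K\subseteq E'$ and $K\simeq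 M_b(Q)$. For a skew brace $Q$ and a (multiplicative) abelian group $K$, a factor set is a pair $(\alpha,\mu)$ of maps $Q\times Q\to K$ such that for all $x,y,z\in Q$: $\alpha(0,y)=\alpha(x,0)=1$, $\mu(0,y)=\mu(x,0)=1$, $\alpha(y,z)\alpha(x+y,z)^{-1}\alpha(x,y+z)\alpha(x,y)^{-1}=1$, $\mu(y,z)\mu(x\circ y,z)^{-1}\mu(x,y\circ z)\mu(x,y)^{-1}=1$, and $\alpha(y,z)\mu(x,y+z)\alpha(-x,x)=\mu(x,z)\alpha(x\circ y,-x)\alpha(x\circ y-x,x\circ z)\mu(x,y)$. Factor sets form a group $Z^2_b(Q,K)$ under pointwise multiplication. For $h:Q\to K$ put $\partial_+h(x,y)=h(y)h(x+y)^{-1}h(x)$ and $\partial_\circ h(x,y)=h(y)h(x\circ y)^{-1}h(x)$. Let $B^2_b(Q,K)=\{(\partial_+h,\partial_\circ h): h:Q\to K,\ h(0)=1\}$ and $H^2_b(Q,K)=Z^2_b(Q,K)/B^2_b(Q,K)$. The Schur multiplier of a finite skew brace $Q$ is $M_b(Q)=H^2_b(Q,\mathbb{C}^\times)$. *)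

theory Defs
  imports Complex_Main "HOL-Algebra.QuotRing" "HOL-Algebra.Generated_Groups"
begin

text \<open>
  A skew brace is carried by the two-operation record of HOL-Algebra: \<open>\<oplus>\<close> is the additive (not
  necessarily commutative) operation and \<open>\<otimes>\<close> is the circle operation.  No ring axiom is assumed.
  With this encoding, the purely operational notions \<^const>\<open>ring_hom\<close>, \<^const>\<open>ring_iso\<close>,
  \<^const>\<open>a_kernel\<close> and \<^const>\<open>FactRing\<close> (additive cosets, with the two induced operations) are the
  homomorphisms, isomorphisms, kernels and quotients of skew braces.
\<close>

locale skew_brace =
  fixes A (structure)
  assumes add_group: "group (add_monoid A)"
    and circ_group: "group A"
    and circ_add: "\<lbrakk>a \<in> carrier A; b \<in> carrier A; c \<in> carrier A\<rbrakk>
      \<Longrightarrow> a \<otimes> (b \<oplus> c) = ((a \<otimes> b) \<ominus> a) \<oplus> (a \<otimes> c)"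
begin

sublocale add: group "add_monoid A"
  rewrites "carrier (add_monoid A) = carrier A"
    and "mult (add_monoid A) = (\<oplus>)"
    and "one (add_monoid A) = \<zero>"
    and "m_inv (add_monoid A) = a_inv A"
  by (rule add_group) (simp_all add: a_inv_def)

sublocale circ: group A
  by (rule circ_group)

text \<open>The two neutral elements agree; this is a consequence of the axioms.\<close>

lemma zero_eq_one: "\<zero> = \<one>"
proof -
  have "\<one> \<otimes> (\<zero> \<oplus> \<zero>) = ((\<one> \<otimes> \<zero>) \<ominus> \<one>) \<oplus> (\<one> \<otimes> \<zero>)"
    by (rule circ_add) simp_all
  then have "\<zero> = \<ominus> \<one>"
    by (simp add: a_minus_def)
  then show ?thesis
    by (metis add.inv_inv add.inv_one circ.one_closed)
qed

end

definition annihilator :: "('a, 'm) ring_scheme \<Rightarrow> 'a set" where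
  "annihilator A = {a \<in> carrier A. \<forall>b \<in> carrier A.
     (\<ominus>\<^bsub>A\<^esub> a) \<oplus>\<^bsub>A\<^esub> (a \<otimes>\<^bsub>A\<^esub> b) = b \<and>
     a \<oplus>\<^bsub>A\<^esub> b = b \<oplus>\<^bsub>A\<^esub> a \<and>
     a \<otimes>\<^bsub>A\<^esub> b = b \<otimes>\<^bsub>A\<^esub> a}"

definition add_commutator :: "('a, 'm) ring_scheme \<Rightarrow> 'a \<Rightarrow> 'a \<Rightarrow> 'a" where
  "add_commutator A a b = ((a \<oplus>\<^bsub>A\<^esub> b) \<ominus>\<^bsub>A\<^esub> a) \<ominus>\<^bsub>A\<^esub> b"

definition star :: "('a, 'm) ring_scheme \<Rightarrow> 'a \<Rightarrow> 'a \<Rightarrow> 'a" where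
  "star A a b = ((\<ominus>\<^bsub>A\<^esub> a) \<oplus>\<^bsub>A\<^esub> (a \<otimes>\<^bsub>A\<^esub> b)) \<ominus>\<^bsub>A\<^esub> b"

definition commutator :: "('a, 'm) ring_scheme \<Rightarrow> 'a set" where
  "commutator A = generate (add_monoid A)
     ({add_commutator A a b | a b. a \<in> carrier A \<and> b \<in> carrier A} \<union>
      {star A a b | a b. a \<in> carrier A \<and> b \<in> carrier A})"

text \<open>
  The maps induced on pairs of cosets of the annihilator: the set of values over all representatives
  is a singleton (\<open>phi_add_coset\<close> and \<open>phi_star_coset\<close> below), and its element is the value.
\<close>

definition phi_add :: "('a, 'm) ring_scheme \<Rightarrow> 'a set \<Rightarrow> 'a set \<Rightarrow> 'a" where
  "phi_add A S T = the_elem {add_commutator A a b | a b. a \<in> S \<and> b \<in> T}"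

definition phi_star :: "('a, 'm) ring_scheme \<Rightarrow> 'a set \<Rightarrow> 'a set \<Rightarrow> 'a" where
  "phi_star A S T = the_elem {star A a b | a b. a \<in> S \<and> b \<in> T}"

definition isoclinic :: "('a, 'm) ring_scheme \<Rightarrow> ('b, 'n) ring_scheme \<Rightarrow> bool" where
  "isoclinic A B \<longleftrightarrow>
     (\<exists>\<xi> \<in> ring_iso (A Quot annihilator A) (B Quot annihilator B).
      \<exists>\<theta> \<in> ring_iso (A\<lparr>carrier := commutator A\<rparr>) (B\<lparr>carrier := commutator B\<rparr>).
        \<forall>S \<in> carrier (A Quot annihilator A). \<forall>T \<in> carrier (A Quot annihilator A).
          \<theta> (phi_add A S T) = phi_add B (\<xi> S) (\<xi> T) \<and>
          \<theta> (phi_star A S T) = phi_star B (\<xi> S) (\<xi> T))"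

definition trivial_brace :: "('k, 'm) monoid_scheme \<Rightarrow> 'k ring" where
  "trivial_brace K = \<lparr>carrier = carrier K, mult = (\<otimes>\<^bsub>K\<^esub>), one = \<one>\<^bsub>K\<^esub>,
     zero = \<one>\<^bsub>K\<^esub>, add = (\<otimes>\<^bsub>K\<^esub>)\<rparr>"

text \<open>The sequence is \<open>0 \<rightarrow> K \<rightarrow> E \<rightarrow> Q \<rightarrow> 0\<close> with maps \<open>i\<close> and \<open>p\<close>.\<close>

definition annihilator_extension ::
  "('k, 'l) monoid_scheme \<Rightarrow> ('k \<Rightarrow> 'e) \<Rightarrow> ('e, 'm) ring_scheme \<Rightarrow> ('e \<Rightarrow> 'q) \<Rightarrow>
   ('q, 'n) ring_scheme \<Rightarrow> bool" where
  "annihilator_extension K i E p Q \<longleftrightarrow>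
     comm_group K \<and> skew_brace E \<and> skew_brace Q \<and>
     i \<in> ring_hom (trivial_brace K) E \<and> inj_on i (carrier K) \<and>
     p \<in> ring_hom E Q \<and> p ` carrier E = carrier Q \<and>
     i ` carrier K = a_kernel E Q p \<and>
     i ` carrier K \<subseteq> annihilator E"

definition factor_set ::
  "('q, 'm) ring_scheme \<Rightarrow> ('k, 'n) monoid_scheme \<Rightarrow>
   ('q \<times> 'q \<Rightarrow> 'k) \<Rightarrow> ('q \<times> 'q \<Rightarrow> 'k) \<Rightarrow> bool" where
  "factor_set Q K \<alpha> \<mu> \<longleftrightarrow>
     \<alpha> \<in> carrier Q \<times> carrier Q \<rightarrow> carrier K \<and> \<mu> \<in> carrier Q \<times> carrier Q \<rightarrow> carrier K \<and>
     (\<forall>x \<in> carrier Q. \<forall>y \<in> carrier Q. \<forall>z \<in> carrier Q.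
        \<alpha> (\<zero>\<^bsub>Q\<^esub>, y) = \<one>\<^bsub>K\<^esub> \<and> \<alpha> (x, \<zero>\<^bsub>Q\<^esub>) = \<one>\<^bsub>K\<^esub> \<and>
        \<mu> (\<zero>\<^bsub>Q\<^esub>, y) = \<one>\<^bsub>K\<^esub> \<and> \<mu> (x, \<zero>\<^bsub>Q\<^esub>) = \<one>\<^bsub>K\<^esub> \<and>
        \<alpha> (y, z) \<otimes>\<^bsub>K\<^esub> inv\<^bsub>K\<^esub> (\<alpha> (x \<oplus>\<^bsub>Q\<^esub> y, z)) \<otimes>\<^bsub>K\<^esub> \<alpha> (x, y \<oplus>\<^bsub>Q\<^esub> z) \<otimes>\<^bsub>K\<^esub> inv\<^bsub>K\<^esub> (\<alpha> (x, y)) = \<one>\<^bsub>K\<^esub> \<and>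
        \<mu> (y, z) \<otimes>\<^bsub>K\<^esub> inv\<^bsub>K\<^esub> (\<mu> (x \<otimes>\<^bsub>Q\<^esub> y, z)) \<otimes>\<^bsub>K\<^esub> \<mu> (x, y \<otimes>\<^bsub>Q\<^esub> z) \<otimes>\<^bsub>K\<^esub> inv\<^bsub>K\<^esub> (\<mu> (x, y)) = \<one>\<^bsub>K\<^esub> \<and>
        \<alpha> (y, z) \<otimes>\<^bsub>K\<^esub> \<mu> (x, y \<oplus>\<^bsub>Q\<^esub> z) \<otimes>\<^bsub>K\<^esub> \<alpha> (\<ominus>\<^bsub>Q\<^esub> x, x) =
          \<mu> (x, z) \<otimes>\<^bsub>K\<^esub> \<alpha> (x \<otimes>\<^bsub>Q\<^esub> y, \<ominus>\<^bsub>Q\<^esub> x) \<otimes>\<^bsub>K\<^esub> \<alpha> ((x \<otimes>\<^bsub>Q\<^esub> y) \<ominus>\<^bsub>Q\<^esub> x, x \<otimes>\<^bsub>Q\<^esub> z) \<otimes>\<^bsub>K\<^esub> \<mu> (x, y))"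

text \<open>
  Maps \<open>Q \<times> Q \<rightarrow> K\<close> are represented by extensional functions, so that two of them are equal as soon
  as they agree on the carrier.
\<close>

definition Z2b :: "('q, 'm) ring_scheme \<Rightarrow> ('k, 'n) monoid_scheme \<Rightarrow>
    (('q \<times> 'q \<Rightarrow> 'k) \<times> ('q \<times> 'q \<Rightarrow> 'k)) monoid" where
  "Z2b Q K =
    \<lparr>carrier = {(\<alpha>, \<mu>). factor_set Q K \<alpha> \<mu> \<and>
        \<alpha> \<in> extensional (carrier Q \<times> carrier Q) \<and> \<mu> \<in> extensional (carrier Q \<times> carrier Q)},
     mult = (\<lambda>(\<alpha>, \<mu>) (\<beta>, \<nu>).
       (\<lambda>u \<in> carrier Q \<times> carrier Q. \<alpha> u \<otimes>\<^bsub>K\<^esub> \<beta> u, \<lambda>u \<in> carrier Q \<times> carrier Q. \<mu> u \<otimes>\<^bsub>K\<^esub> \<nu> u)),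
     one = (\<lambda>u \<in> carrier Q \<times> carrier Q. \<one>\<^bsub>K\<^esub>, \<lambda>u \<in> carrier Q \<times> carrier Q. \<one>\<^bsub>K\<^esub>)\<rparr>"

text \<open>
  The coboundary of \<open>h\<close> for one operation: \<open>G\<close> is \<open>add_monoid Q\<close> for \<open>\<partial>\<^sub>+\<close>, and \<open>Q\<close> itself for the
  circle operation.
\<close>

definition coboundary :: "('q, 'm) monoid_scheme \<Rightarrow> ('k, 'n) monoid_scheme \<Rightarrow>
    ('q \<Rightarrow> 'k) \<Rightarrow> ('q \<times> 'q \<Rightarrow> 'k)" where
  "coboundary G K h =
     (\<lambda>(x, y) \<in> carrier G \<times> carrier G. h y \<otimes>\<^bsub>K\<^esub> inv\<^bsub>K\<^esub> (h (x \<otimes>\<^bsub>G\<^esub> y)) \<otimes>\<^bsub>K\<^esub> h x)"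

definition B2b :: "('q, 'm) ring_scheme \<Rightarrow> ('k, 'n) monoid_scheme \<Rightarrow>
    (('q \<times> 'q \<Rightarrow> 'k) \<times> ('q \<times> 'q \<Rightarrow> 'k)) set" where
  "B2b Q K = {(coboundary (add_monoid Q) K h, coboundary Q K h) | h.
     h \<in> carrier Q \<rightarrow> carrier K \<and> h \<zero>\<^bsub>Q\<^esub> = \<one>\<^bsub>K\<^esub>}"

definition H2b :: "('q, 'm) ring_scheme \<Rightarrow> ('k, 'n) monoid_scheme \<Rightarrow>
    (('q \<times> 'q \<Rightarrow> 'k) \<times> ('q \<times> 'q \<Rightarrow> 'k)) set monoid" where
  "H2b Q K = Z2b Q K Mod B2b Q K"

definition complex_units :: "complex monoid" where
  "complex_units = \<lparr>carrier = UNIV - {0}, mult = (*), one = 1\<rparr>"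

definition schur_multiplier :: "('q, 'm) ring_scheme \<Rightarrow>
    (('q \<times> 'q \<Rightarrow> complex) \<times> ('q \<times> 'q \<Rightarrow> complex)) set monoid" where
  "schur_multiplier Q = H2b Q complex_units"

text \<open>
  HOL cannot quantify over the type of \<open>K\<close>.  Taking the elements of \<open>K\<close> in the type of \<open>E\<close> loses no
  generality, since \<open>K\<close> is isomorphic to its image in \<open>E\<close>.  That \<open>E\<close> is a skew brace is part of
  \<^const>\<open>annihilator_extension\<close>.
\<close>

definition schur_cover :: "('q, 'n) ring_scheme \<Rightarrow> ('e, 'm) ring_scheme \<Rightarrow> bool" where
  "schur_cover Q E \<longleftrightarrow>
     (\<exists>(K :: 'e monoid) i p. annihilator_extension K i E p Q \<and>
        i ` carrier K \<subseteq> commutator E \<and> K \<cong> schur_multiplier Q)"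

context skew_brace
begin

lemma annihilatorD:
  assumes "z \<in> annihilator A"
  shows "z \<in> carrier A" "\<And>b. b \<in> carrier A \<Longrightarrow> z \<oplus> b = b \<oplus> z"
    "\<And>b. b \<in> carrier A \<Longrightarrow> z \<otimes> b = b \<otimes> z" "\<And>b. b \<in> carrier A \<Longrightarrow> z \<otimes> b = z \<oplus> b"
proof -
  show z: "z \<in> carrier A" and "\<And>b. b \<in> carrier A \<Longrightarrow> z \<oplus> b = b \<oplus> z"
    and "\<And>b. b \<in> carrier A \<Longrightarrow> z \<otimes> b = b \<otimes> z"
    using assms by (auto simp: annihilator_def)
  fix b assume b: "b \<in> carrier A"
  have "(\<ominus> z) \<oplus> (z \<otimes> b) = b"
    using assms b by (auto simp: annihilator_def)
  then show "z \<otimes> b = z \<oplus> b"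
    using z b by (metis add.inv_solve_left circ.m_closed)
qed

lemma add_cancel_central:
  assumes "z \<in> annihilator A" "x \<in> carrier A" "a \<in> carrier A"
  shows "(z \<oplus> x) \<ominus> (z \<oplus> a) = x \<ominus> a"
proof -
  note z = annihilatorD[OF assms(1)]
  have "(z \<oplus> x) \<ominus> (z \<oplus> a) = (x \<oplus> z) \<oplus> (\<ominus> (a \<oplus> z))"
    using z assms by (simp add: a_minus_def)
  also have "\<dots> = x \<oplus> (z \<oplus> ((\<ominus> z) \<oplus> (\<ominus> a)))"
    using z(1) assms(2,3) by (simp add: add.inv_mult_group add.m_assoc)
  also have "\<dots> = x \<ominus> a"
    using z(1) assms(2,3) by (simp add: a_minus_def flip: add.m_assoc)
  finally show ?thesis .
qed

lemma add_commutator_annihilator: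
  assumes z: "z \<in> annihilator A" and w: "w \<in> annihilator A"
    and a: "a \<in> carrier A" and b: "b \<in> carrier A"
  shows "add_commutator A (z \<oplus> a) (w \<oplus> b) = add_commutator A a b"
proof -
  note z' = annihilatorD[OF z] and w' = annihilatorD[OF w]
  have "(z \<oplus> a) \<oplus> (w \<oplus> b) = z \<oplus> (w \<oplus> (a \<oplus> b))"
    using z'(1) w' a b by (metis add.m_assoc add.m_closed)
  then have "((z \<oplus> a) \<oplus> (w \<oplus> b)) \<ominus> (z \<oplus> a) = (w \<oplus> (a \<oplus> b)) \<ominus> a"
    using add_cancel_central[OF z, of "w \<oplus> (a \<oplus> b)" a] w'(1) a b by simp
  also have "\<dots> = w \<oplus> ((a \<oplus> b) \<ominus> a)"
    using w'(1) a b by (simp add: a_minus_def add.m_assoc)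
  finally show ?thesis
    using add_cancel_central[OF w, of "(a \<oplus> b) \<ominus> a" b] a b
    by (simp add: add_commutator_def a_minus_def)
qed

lemma star_annihilator:
  assumes z: "z \<in> annihilator A" and w: "w \<in> annihilator A"
    and a: "a \<in> carrier A" and b: "b \<in> carrier A"
  shows "star A (z \<oplus> a) (w \<oplus> b) = star A a b"
proof -
  note z' = annihilatorD[OF z] and w' = annihilatorD[OF w]
  have "(z \<oplus> a) \<otimes> (w \<oplus> b) = (z \<otimes> a) \<otimes> (w \<otimes> b)"
    using z'(4) w'(4) a b by simp
  also have "\<dots> = z \<otimes> (w \<otimes> (a \<otimes> b))"
    using z'(1) w'(1,3) a b by (metis circ.m_assoc circ.m_closed)
  also have "\<dots> = z \<oplus> (w \<oplus> (a \<otimes> b))"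
    using z'(4) w'(1,4) a b by simp
  finally have eq: "(z \<oplus> a) \<otimes> (w \<oplus> b) = z \<oplus> (w \<oplus> (a \<otimes> b))" .
  have "(\<ominus> (z \<oplus> a)) \<oplus> ((z \<oplus> a) \<otimes> (w \<oplus> b)) = (\<ominus> a) \<oplus> (w \<oplus> (a \<otimes> b))"
  proof -
    have "(\<ominus> (z \<oplus> a)) \<oplus> (z \<oplus> v) = (\<ominus> a) \<oplus> v" if v: "v \<in> carrier A" for v
    proof -
      have "z \<oplus> v = z \<oplus> (a \<oplus> ((\<ominus> a) \<oplus> v))"
        using a v by (simp flip: add.m_assoc)
      also have "\<dots> = (z \<oplus> a) \<oplus> ((\<ominus> a) \<oplus> v)"
        using z'(1) a v by (simp add: add.m_assoc)
      finally have "(\<ominus> (z \<oplus> a)) \<oplus> (z \<oplus> v) = (\<ominus> (z \<oplus> a)) \<oplus> ((z \<oplus> a) \<oplus> ((\<ominus> a) \<oplus> v))"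
        by simp
      also have "\<dots> = ((\<ominus> (z \<oplus> a)) \<oplus> (z \<oplus> a)) \<oplus> ((\<ominus> a) \<oplus> v)"
        using z'(1) a v by (simp only: add.m_assoc add.m_closed add.inv_closed)
      also have "\<dots> = (\<ominus> a) \<oplus> v"
        using z'(1) a v by simp
      finally show ?thesis .
    qed
    then show ?thesis
      using w'(1) a b unfolding eq by simp
  qed
  also have "\<dots> = w \<oplus> ((\<ominus> a) \<oplus> (a \<otimes> b))"
  proof -
    have "(\<ominus> a) \<oplus> (w \<oplus> (a \<otimes> b)) = ((\<ominus> a) \<oplus> w) \<oplus> (a \<otimes> b)"
      using w'(1) a b by (simp add: add.m_assoc)
    also have "\<dots> = (w \<oplus> (\<ominus> a)) \<oplus> (a \<otimes> b)"
      using w'(2) a by simp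
    also have "\<dots> = w \<oplus> ((\<ominus> a) \<oplus> (a \<otimes> b))"
      using w'(1) a b by (simp add: add.m_assoc)
    finally show ?thesis .
  qed
  finally show ?thesis
    using add_cancel_central[OF w, of "(\<ominus> a) \<oplus> (a \<otimes> b)" b] a b
    by (simp add: star_def)
qed

lemma zero_in_annihilator: "\<zero> \<in> annihilator A"
proof -
  have "\<zero> \<otimes> b = b" "b \<otimes> \<zero> = b" if "b \<in> carrier A" for b
    using that circ.l_one circ.r_one by (simp_all only: zero_eq_one)
  moreover have "\<zero> \<oplus> b = b" "b \<oplus> \<zero> = b" "\<ominus> \<zero> = \<zero>" if "b \<in> carrier A" for b
    using that add.l_one add.r_one add.inv_one by simp_all
  ultimately show ?thesis
    using add.one_closed by (auto simp only: annihilator_def)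
qed

lemma coset_annihilator:
  "a \<in> carrier A \<Longrightarrow> annihilator A +> a = {z \<oplus> a | z. z \<in> annihilator A}"
  by (auto simp: a_r_coset_def r_coset_def)

lemma phi_add_coset:
  assumes a: "a \<in> carrier A" and b: "b \<in> carrier A"
  shows "phi_add A (annihilator A +> a) (annihilator A +> b) = add_commutator A a b"
proof -
  have "{add_commutator A x y | x y. x \<in> annihilator A +> a \<and> y \<in> annihilator A +> b}
      = {add_commutator A a b}" (is "?S = _")
  proof
    note cosets = coset_annihilator[OF a] coset_annihilator[OF b]
    show "?S \<subseteq> {add_commutator A a b}"
      unfolding cosets using add_commutator_annihilator[OF _ _ a b] by auto
    have "add_commutator A (\<zero> \<oplus> a) (\<zero> \<oplus> b) \<in> ?S"
      unfolding cosets using zero_in_annihilator by blast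
    then show "{add_commutator A a b} \<subseteq> ?S"
      using add_commutator_annihilator[OF zero_in_annihilator zero_in_annihilator a b] by simp
  qed
  then show ?thesis
    by (simp add: phi_add_def)
qed

lemma phi_star_coset:
  assumes a: "a \<in> carrier A" and b: "b \<in> carrier A"
  shows "phi_star A (annihilator A +> a) (annihilator A +> b) = star A a b"
proof -
  have "{star A x y | x y. x \<in> annihilator A +> a \<and> y \<in> annihilator A +> b} = {star A a b}"
    (is "?S = _")
  proof
    note cosets = coset_annihilator[OF a] coset_annihilator[OF b]
    show "?S \<subseteq> {star A a b}"
      unfolding cosets using star_annihilator[OF _ _ a b] by auto
    have "star A (\<zero> \<oplus> a) (\<zero> \<oplus> b) \<in> ?S"
      unfolding cosets using zero_in_annihilator by blast
    then show "{star A a b} \<subseteq> ?S"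
      using star_annihilator[OF zero_in_annihilator zero_in_annihilator a b] by simp
  qed
  then show ?thesis
    by (simp add: phi_star_def)
qed

end

end

theory Submission
  imports Defs "HOL-Algebra.Multiplicative_Group"
begin

text \<open>
  Let \<open>0 \<rightarrow> K \<rightarrow> E \<rightarrow> Q \<rightarrow> 0\<close> be a Schur cover. Composing its factor set with characters of \<open>K\<close> gives
  the transgression from the characters of \<open>K\<close> to \<open>M\<^sub>b(Q)\<close>. It is injective since \<open>K \<subseteq> E'\<close>, and
  \<open>M\<^sub>b(Q)\<close> is finite of the same order as \<open>K\<close>, so it is bijective; hence every factor set of \<open>Q\<close> with
  values in \<open>\<complex>\<^sup>\<times>\<close> becomes a coboundary after inflation to \<open>E\<close>.

  Given a second cover \<open>0 \<rightarrow> L \<rightarrow> F \<rightarrow> Q \<rightarrow> 0\<close>, let \<open>P\<close> be the fibre product of \<open>E\<close> and \<open>F\<close> over \<open>Q\<close>.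
  Inflated to \<open>F\<close>, the transgression of a character \<open>\<chi>\<close> of \<open>L\<close> is a coboundary, trivialized by an
  extension of \<open>\<chi>\<close> to a map on \<open>F\<close>; it is also trivialized on \<open>E\<close>. The quotient of the two
  trivializations is a homomorphism from \<open>P\<close> to \<open>\<complex>\<^sup>\<times>\<close>, so it vanishes on \<open>P'\<close>: if \<open>(0, l) \<in> P'\<close>, then
  \<open>\<chi>(l) = 1\<close> for every \<open>\<chi>\<close>, and \<open>l = 0\<close>. By symmetry, \<open>P'\<close> is the graph of an isomorphism between \<open>E'\<close>
  and \<open>F'\<close>, and this isomorphism respects commutators and stars.
\<close>

section \<open>Characters of finite abelian groups\<close>

lemma hom_complex_units_iff:
  "\<chi> \<in> hom G complex_units \<longleftrightarrow>
    (\<forall>x\<in>carrier G. \<chi> x \<noteq> 0) \<and>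
    (\<forall>x\<in>carrier G. \<forall>y\<in>carrier G. \<chi> (x \<otimes>\<^bsub>G\<^esub> y) = \<chi> x * \<chi> y)"
  by (auto simp: hom_def complex_units_def)

context comm_group
begin

text \<open>The subgroup generated by \<open>H\<close> and \<open>a\<close> when \<open>G\<close> is
  finite: inverses of powers of \<open>a\<close> are then again powers with natural
  exponent.\<close>

definition adjoin :: "'a set \<Rightarrow> 'a \<Rightarrow> 'a set" where
  "adjoin H a = {h \<otimes> a [^] k | h (k :: nat). h \<in> H}"

lemma subset_adjoin:
  assumes "subgroup H G" "a \<in> carrier G"
  shows "insert a H \<subseteq> adjoin H a"
proof -
  have "a = \<one> \<otimes> a [^] (1 :: nat)" "h = h \<otimes> a [^] (0 :: nat)" if "h \<in> H" for h
    using assms that by (auto simp: subgroup.mem_carrier)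
  then show ?thesis
    unfolding adjoin_def using subgroup.one_closed[OF assms(1)] by blast
qed

lemma subgroup_adjoin:
  assumes "finite (carrier G)" "subgroup H G" "a \<in> carrier G"
  shows "subgroup (adjoin H a) G"
proof (rule subgroupI)
  note H = subgroup.mem_carrier[OF assms(2)]
  show "adjoin H a \<subseteq> carrier G" "adjoin H a \<noteq> {}"
    using H assms(3) subset_adjoin[OF assms(2,3)] by (auto simp: adjoin_def)
  fix x assume "x \<in> adjoin H a"
  then obtain h and k :: nat where x: "h \<in> H" "x = h \<otimes> a [^] k"
    by (auto simp: adjoin_def)
  have "inv (a [^] k) = a [^] ((order G - 1) * k)"
  proof (rule inv_equality)
    have "(order G - 1) * k + k = order G * k"
      using assms(1) order_gt_0_iff_finite by (cases "order G") auto
    then show "a [^] ((order G - 1) * k) \<otimes> a [^] k = \<one>"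
      using assms(3) pow_order_eq_1[of a] by (simp add: nat_pow_mult) (simp flip: nat_pow_pow)
  qed (use assms in auto)
  then show "inv x \<in> adjoin H a"
    using x H assms(2,3) by (auto simp: adjoin_def inv_mult subgroup.m_inv_closed)
  fix y assume "y \<in> adjoin H a"
  then obtain h' and k' :: nat where y: "h' \<in> H" "y = h' \<otimes> a [^] k'"
    by (auto simp: adjoin_def)
  have "x \<otimes> y = (h \<otimes> h') \<otimes> a [^] (k + k')"
    using x y H assms(3) by (simp add: m_ac flip: nat_pow_mult)
  then show "x \<otimes> y \<in> adjoin H a"
    using x y assms(2) by (auto simp: adjoin_def subgroup.m_closed)
qed

text \<open>Each adjunction of an outside element shrinks the complement of \<open>H\<close>, so
  finitely many of them reach the whole group. Statements about characters are thereby reduced to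
  extension by one element.\<close>

lemma adjoin_induct [consumes 2, case_names base step]:
  assumes "finite (carrier G)" "subgroup H G" "P H"
    and step: "\<And>H a. \<lbrakk>subgroup H G; P H; a \<in> carrier G; a \<notin> H\<rbrakk> \<Longrightarrow> P (adjoin H a)"
  shows "P (carrier G)"
  using assms(2,3)
proof (induction "card (carrier G - H)" arbitrary: H rule: less_induct)
  case less
  show ?case
  proof (cases "H = carrier G")
    case False
    then obtain a where a: "a \<in> carrier G" "a \<notin> H"
      using subgroup.subset[OF less.prems(1)] by blast
    have "card (carrier G - adjoin H a) < card (carrier G - H)"
      using subset_adjoin[OF less.prems(1) a(1)] a assms(1) by (intro psubset_card_mono) auto
    then show ?thesis
      using less.hyps subgroup_adjoin[OF assms(1) less.prems(1) a(1)] step less.prems a by blast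
  qed (use less in simp)
qed

lemma extend_character:
  assumes fin: "finite (carrier G)" and H: "subgroup H G" and a: "a \<in> carrier G" "a \<notin> H"
  obtains n :: nat where "n > 1" "a [^] n \<in> H" "card (adjoin H a) \<le> n * card H"
    "\<And>\<chi> z. \<lbrakk>\<chi> \<in> hom (G\<lparr>carrier := H\<rparr>) complex_units; z ^ n = \<chi> (a [^] n)\<rbrakk> \<Longrightarrow>
      \<exists>\<psi> \<in> hom (G\<lparr>carrier := adjoin H a\<rparr>) complex_units. (\<forall>h\<in>H. \<psi> h = \<chi> h) \<and> \<psi> a = z"
proof -
  note Hc = subgroup.mem_carrier[OF H]
  note Hm = subgroup.m_closed[OF H] subgroup.m_inv_closed[OF H] subgroup.one_closed[OF H]
  define n where "n = (LEAST n :: nat. n > 0 \<and> a [^] n \<in> H)"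
  have "order G > 0 \<and> a [^] order G \<in> H"
    using fin a Hm pow_order_eq_1 order_gt_0_iff_finite by auto
  then have n: "n > 0" "a [^] n \<in> H"
    unfolding n_def by (rule LeastI2_ex[OF exI]; simp)+
  have less_n: "k = 0" if "k < n" "a [^] k \<in> H" for k :: nat
    using that not_less_Least[of k "\<lambda>n. n > 0 \<and> a [^] n \<in> H"] unfolding n_def by auto
  have Hpow: "h [^] (j :: nat) \<in> H" if "h \<in> H" for h j
    by (induction j) (use that Hm in auto)
  have pow_split: "a [^] k = (a [^] n) [^] (k div n) \<otimes> a [^] (k mod n)" for k :: nat
    using a by (simp add: nat_pow_pow nat_pow_mult)
  \<comment> \<open>The remainder of \<open>k\<close> modulo \<open>n\<close> is again an exponent
    that leads into \<open>H\<close>, so minimality of \<open>n\<close> forces it to be 0.\<close>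
  have dvd: "n dvd k" if "a [^] k \<in> H" for k :: nat
  proof -
    have "a [^] (k mod n) = inv ((a [^] n) [^] (k div n)) \<otimes> a [^] k"
      using pow_split[of k] a by (metis inv_solve_left nat_pow_closed)
    then have "a [^] (k mod n) \<in> H"
      using that Hm Hpow n by simp
    then show ?thesis
      using less_n[of "k mod n"] n(1) by auto
  qed
  have "n \<noteq> 1"
    using a n by auto
  moreover have "adjoin H a \<subseteq> (\<lambda>(h, k). h \<otimes> a [^] k) ` (H \<times> {..<n})"
  proof
    fix x assume "x \<in> adjoin H a"
    then obtain h and k :: nat where x: "h \<in> H" "x = h \<otimes> a [^] k"
      by (auto simp: adjoin_def)
    have "x = (h \<otimes> (a [^] n) [^] (k div n)) \<otimes> a [^] (k mod n)"
      using x a Hc pow_split[of k] by (simp add: m_assoc)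
    moreover have "h \<otimes> (a [^] n) [^] (k div n) \<in> H" "k mod n < n"
      using x n Hm Hpow by auto
    ultimately show "x \<in> (\<lambda>(h, k). h \<otimes> a [^] k) ` (H \<times> {..<n})"
      by force
  qed
  then have "card (adjoin H a) \<le> card (H \<times> {..<n})"
    using finite_subset[OF subgroup.subset[OF H] fin] by (intro surj_card_le) auto
  then have "card (adjoin H a) \<le> n * card H"
    by (simp add: card_cartesian_product mult.commute)
  moreover have "\<exists>\<psi> \<in> hom (G\<lparr>carrier := adjoin H a\<rparr>) complex_units.
      (\<forall>h\<in>H. \<psi> h = \<chi> h) \<and> \<psi> a = z"
    if chi: "\<chi> \<in> hom (G\<lparr>carrier := H\<rparr>) complex_units" and z: "z ^ n = \<chi> (a [^] n)" for \<chi> z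
  proof -
    have chi_nz: "\<chi> h \<noteq> 0" and chi_mult: "\<chi> (h \<otimes> h') = \<chi> h * \<chi> h'" if "h \<in> H" "h' \<in> H" for h h'
      using chi that by (auto simp: hom_complex_units_iff)
    have chi_one: "\<chi> \<one> = 1"
      using chi_mult[of \<one> \<one>] chi_nz[of \<one> \<one>] Hm by simp
    have chi_pow: "\<chi> (h [^] (j :: nat)) = \<chi> h ^ j" if "h \<in> H" for h j
      by (induction j) (use that chi_mult chi_one Hpow in auto)
    have z_nz: "z \<noteq> 0"
      using z n chi_nz[of "a [^] n"] by (auto simp: power_0_left)
    have chi_a: "\<chi> (a [^] k) = z ^ k" if k: "a [^] k \<in> H" for k
    proof -
      obtain j where "k = n * j"
        using dvd[OF k] by blast
      then show ?thesis
        using a n chi_pow z by (simp add: power_mult flip: nat_pow_pow)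
    qed
    \<comment> \<open>Well-definedness: two representations of one element differ by
      \<open>a [^] (k' - k)\<close>, which lies in \<open>H\<close>, where \<chi> already takes the
      value \<open>z ^ (k' - k)\<close>. The representation chosen in \<open>\<psi>\<close> below is
      therefore immaterial.\<close>
    have le: "\<chi> h * z ^ k = \<chi> h' * z ^ k'"
      if eq: "h \<otimes> a [^] k = h' \<otimes> a [^] k'" and h: "h \<in> H" "h' \<in> H" and "k \<le> k'" for h h' and k k' :: nat
    proof -
      have "h \<otimes> a [^] k = (h' \<otimes> a [^] (k' - k)) \<otimes> a [^] k"
        using eq a Hc h \<open>k \<le> k'\<close> by (simp add: nat_pow_mult m_assoc)
      then have h_eq: "h = h' \<otimes> a [^] (k' - k)"
        using a Hc h by simp
      then have "a [^] (k' - k) = inv h' \<otimes> h"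
        using a Hc h by (simp flip: m_assoc)
      then have "a [^] (k' - k) \<in> H"
        using Hm h by simp
      then have "\<chi> h = \<chi> h' * z ^ (k' - k)"
        using h_eq chi_mult chi_a h by metis
      then show ?thesis
        using \<open>k \<le> k'\<close> by (simp add: mult.assoc flip: power_add)
    qed
    define \<psi> where "\<psi> x = (SOME w. \<exists>h\<in>H. \<exists>k :: nat. x = h \<otimes> a [^] k \<and> w = \<chi> h * z ^ k)" for x
    have psi: "\<psi> (h \<otimes> a [^] k) = \<chi> h * z ^ k" if "h \<in> H" for h and k :: nat
      unfolding \<psi>_def
    proof (rule someI2)
      show "\<exists>h'\<in>H. \<exists>k' :: nat. h \<otimes> a [^] k = h' \<otimes> a [^] k' \<and> \<chi> h * z ^ k = \<chi> h' * z ^ k'"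
        using that by blast
    next
      fix w assume "\<exists>h'\<in>H. \<exists>k' :: nat. h \<otimes> a [^] k = h' \<otimes> a [^] k' \<and> w = \<chi> h' * z ^ k'"
      then show "w = \<chi> h * z ^ k"
        using le that by (metis nat_le_linear)
    qed
    have "\<psi> h = \<chi> h" if "h \<in> H" for h
      using psi[OF that, of 0] that Hc by simp
    moreover have "\<psi> a = z"
      using psi[OF Hm(3), of 1] a chi_one by simp
    moreover have "\<psi> \<in> hom (G\<lparr>carrier := adjoin H a\<rparr>) complex_units"
    proof -
      have "\<psi> x \<noteq> 0 \<and> \<psi> (x \<otimes> y) = \<psi> x * \<psi> y" if xy: "x \<in> adjoin H a" "y \<in> adjoin H a" for x y
      proof -
        from xy obtain h h' and k k' :: nat where
          x: "h \<in> H" "x = h \<otimes> a [^] k" and y: "h' \<in> H" "y = h' \<otimes> a [^] k'"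
          by (auto simp: adjoin_def)
        have "x \<otimes> y = (h \<otimes> h') \<otimes> a [^] (k + k')"
          using x y Hc a by (simp add: m_ac flip: nat_pow_mult)
        then show ?thesis
          using x y psi Hm chi_mult chi_nz z_nz by (simp add: power_add)
      qed
      then show ?thesis
        by (auto simp: hom_complex_units_iff)
    qed
    ultimately show ?thesis
      by blast
  qed
  ultimately show thesis
    using n by (intro that[of n]) auto
qed

lemma trivial_character: "(\<lambda>x. 1) \<in> hom (G\<lparr>carrier := H\<rparr>) complex_units"
  by (simp add: hom_complex_units_iff)

text \<open>The induction starts at the cyclic subgroup generated by \<open>g\<close>. There
  \<open>g\<close> may be sent to any \<open>n\<close>-th root of unity with \<open>n > 1\<close>
  the order of \<open>g\<close>, in particular to one different from 1; later extensions keep this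
  value.\<close>

lemma exists_character_neq_1:
  assumes fin: "finite (carrier G)" and g: "g \<in> carrier G" "g \<noteq> \<one>"
  obtains \<chi> where "\<chi> \<in> hom G complex_units" "\<chi> g \<noteq> 1"
proof -
  let ?P = "\<lambda>H. \<exists>\<chi> \<in> hom (G\<lparr>carrier := H\<rparr>) complex_units. g \<in> H \<and> \<chi> g \<noteq> 1"
  have triv: "subgroup {\<one>} G"
    by (rule triv_subgroup)
  have "?P (carrier G)"
  proof (rule adjoin_induct[OF fin subgroup_adjoin[OF fin triv g(1)]])
    obtain n :: nat where n: "n > 1" "\<And>\<chi> z. \<lbrakk>\<chi> \<in> hom (G\<lparr>carrier := {\<one>}\<rparr>) complex_units; z ^ n = \<chi> (g [^] n)\<rbrakk> \<Longrightarrow>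
        \<exists>\<psi> \<in> hom (G\<lparr>carrier := adjoin {\<one>} g\<rparr>) complex_units. (\<forall>h\<in>{\<one>}. \<psi> h = \<chi> h) \<and> \<psi> g = z"
      using extend_character[OF fin triv g(1)] g(2) by (metis singletonD)
    have "card {z :: complex. z ^ n = 1} = n"
      using n(1) by (intro card_nth_roots) auto
    then have "\<not> {z :: complex. z ^ n = 1} \<subseteq> {1}"
      using n(1) card_mono[of "{1 :: complex}" "{z. z ^ n = 1}"] by auto
    then obtain z :: complex where "z ^ n = 1" "z \<noteq> 1"
      by blast
    with n(2)[OF trivial_character, of z] show "?P (adjoin {\<one>} g)"
      using subset_adjoin[OF triv g(1)] by auto
  next
    fix H a assume H: "subgroup H G" "?P H" and a: "a \<in> carrier G" "a \<notin> H"
    obtain n :: nat where n: "n > 1" "a [^] n \<in> H"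
      "\<And>\<chi> z. \<lbrakk>\<chi> \<in> hom (G\<lparr>carrier := H\<rparr>) complex_units; z ^ n = \<chi> (a [^] n)\<rbrakk> \<Longrightarrow>
        \<exists>\<psi> \<in> hom (G\<lparr>carrier := adjoin H a\<rparr>) complex_units. (\<forall>h\<in>H. \<psi> h = \<chi> h) \<and> \<psi> a = z"
      using extend_character[OF fin H(1) a] by metis
    obtain \<chi> where chi: "\<chi> \<in> hom (G\<lparr>carrier := H\<rparr>) complex_units" "g \<in> H" "\<chi> g \<noteq> 1"
      using H(2) by blast
    have "\<chi> (a [^] n) \<noteq> 0"
      using chi(1) n(2) by (simp add: hom_complex_units_iff)
    then have "card {z. z ^ n = \<chi> (a [^] n)} = n"
      using n(1) by (intro card_nth_roots) auto
    then obtain z where "z ^ n = \<chi> (a [^] n)"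
      using n(1) by (cases "{z. z ^ n = \<chi> (a [^] n)} = {}") auto
    then show "?P (adjoin H a)"
      using n(3)[OF chi(1)] chi(2,3) subset_adjoin[OF H(1) a(1)] by (metis insert_subset subsetD)
  qed
  then show thesis
    using that by auto
qed

text \<open>Adjoining \<open>a\<close> multiplies the order by at most \<open>n\<close>, while each
  character of \<open>H\<close> has one extension for each of the \<open>n\<close> roots of
  \<open>\<chi> (a [^] n)\<close>. Extensionality makes distinct functions differ on the subgroup
  itself.\<close>

lemma order_le_card_characters:
  assumes fin: "finite (carrier G)"
  obtains S where "S \<subseteq> hom G complex_units \<inter> extensional (carrier G)" "finite S" "order G \<le> card S"
proof -
  let ?P = "\<lambda>H. \<exists>S \<subseteq> hom (G\<lparr>carrier := H\<rparr>) complex_units \<inter> extensional H. finite S \<and> card H \<le> card S"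
  have "?P (carrier G)"
  proof (rule adjoin_induct[OF fin triv_subgroup])
    have "(\<lambda>x\<in>{\<one>}. 1) \<in> hom (G\<lparr>carrier := {\<one>}\<rparr>) complex_units \<inter> extensional {\<one>}"
      by (simp add: hom_complex_units_iff)
    then show "?P {\<one>}"
      by (intro exI[of _ "{\<lambda>x\<in>{\<one>}. 1}"]) simp
  next
    fix H a assume H: "subgroup H G" "?P H" and a: "a \<in> carrier G" "a \<notin> H"
    note sub = subset_adjoin[OF H(1) a(1)]
    obtain n :: nat where n: "n > 1" "a [^] n \<in> H" "card (adjoin H a) \<le> n * card H"
      "\<And>\<chi> z. \<lbrakk>\<chi> \<in> hom (G\<lparr>carrier := H\<rparr>) complex_units; z ^ n = \<chi> (a [^] n)\<rbrakk> \<Longrightarrow>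
        \<exists>\<psi> \<in> hom (G\<lparr>carrier := adjoin H a\<rparr>) complex_units. (\<forall>h\<in>H. \<psi> h = \<chi> h) \<and> \<psi> a = z"
      by (rule extend_character[OF fin H(1) a]) (rule that)
    obtain S where S: "S \<subseteq> hom (G\<lparr>carrier := H\<rparr>) complex_units \<inter> extensional H" "finite S" "card H \<le> card S"
      using H(2) by (elim exE conjE)
    \<comment> \<open>A pair records a character of \<open>H\<close> and an admissible value at
      \<open>a\<close>. Restricting the extension to \<open>H\<close> and evaluating it at
      \<open>a\<close> recovers the pair, hence distinct pairs give distinct extensions.\<close>
    let ?D = "SIGMA \<chi>:S. {z. z ^ n = \<chi> (a [^] n)}"
    define \<Psi> where "\<Psi> d = (SOME \<psi>. \<psi> \<in> hom (G\<lparr>carrier := adjoin H a\<rparr>) complex_units \<and>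
        (\<forall>h\<in>H. \<psi> h = fst d h) \<and> \<psi> a = snd d)" for d
    have Psi: "\<Psi> d \<in> hom (G\<lparr>carrier := adjoin H a\<rparr>) complex_units \<and>
        (\<forall>h\<in>H. \<Psi> d h = fst d h) \<and> \<Psi> d a = snd d" if "d \<in> ?D" for d
    proof -
      have d: "fst d \<in> S" "snd d ^ n = fst d (a [^] n)"
        using that by auto
      then have "fst d \<in> hom (G\<lparr>carrier := H\<rparr>) complex_units"
        using S(1) by blast
      from n(4)[OF this d(2)] show ?thesis
        unfolding \<Psi>_def Bex_def by (rule someI_ex)
    qed
    define T where "T = (\<lambda>d. restrict (\<Psi> d) (adjoin H a)) ` ?D"
    have nz: "\<chi> (a [^] n) \<noteq> 0" if "\<chi> \<in> S" for \<chi>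
      using S(1) that n(2) by (auto simp: hom_complex_units_iff)
    have finD: "finite ?D"
      using S(2) n(1) by (intro finite_SigmaI) auto
    have "inj_on (\<lambda>d. restrict (\<Psi> d) (adjoin H a)) ?D"
    proof (rule inj_onI)
      fix c d assume cd: "c \<in> ?D" "d \<in> ?D"
        and eq: "restrict (\<Psi> c) (adjoin H a) = restrict (\<Psi> d) (adjoin H a)"
      then have "\<Psi> c x = \<Psi> d x" if "x \<in> insert a H" for x
        using sub that by (metis restrict_apply' subsetD)
      then have "snd c = snd d" "\<forall>h\<in>H. fst c h = fst d h"
        using Psi[OF cd(1)] Psi[OF cd(2)] by (metis insertCI)+
      moreover have "fst c \<in> extensional H" "fst d \<in> extensional H"
        using cd S(1) by auto
      ultimately show "c = d"
        by (intro prod_eqI extensionalityI[of _ H]) auto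
    qed
    then have "card T = card ?D"
      unfolding T_def by (rule card_image)
    also have "\<dots> = (\<Sum>\<chi>\<in>S. card {z. z ^ n = \<chi> (a [^] n)})"
      using S(2) n(1) by (intro card_SigmaI) auto
    also have "\<dots> = card S * n"
      using card_nth_roots[OF nz] n(1) by simp
    finally have "card (adjoin H a) \<le> card T"
      using n(3) S(3) by (metis le_trans mult.commute mult_le_mono2)
    moreover have "finite T"
      using finD T_def by simp
    moreover have "T \<subseteq> hom (G\<lparr>carrier := adjoin H a\<rparr>) complex_units \<inter> extensional (adjoin H a)"
    proof -
      have "x \<otimes> y \<in> adjoin H a" if "x \<in> adjoin H a" "y \<in> adjoin H a" for x y
        using that subgroup_adjoin[OF fin H(1) a(1)] by (simp add: subgroup.m_closed)
      then have "restrict \<psi> (adjoin H a) \<in> hom (G\<lparr>carrier := adjoin H a\<rparr>) complex_units"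
        if "\<psi> \<in> hom (G\<lparr>carrier := adjoin H a\<rparr>) complex_units" for \<psi>
        using that by (simp add: hom_complex_units_iff)
      then show ?thesis
        using Psi unfolding T_def by (intro image_subsetI IntI) auto
    qed
    ultimately show "?P (adjoin H a)"
      by (intro exI[of _ T] conjI)
  qed
  then show thesis
    using that by (auto simp: order_def)
qed

end

section \<open>Factor sets with values in the nonzero complex numbers\<close>

lemma comm_group_complex_units: "comm_group complex_units"
  unfolding complex_units_def
  by (rule comm_groupI) (auto, metis DiffI UNIV_I left_inverse nonzero_imp_inverse_nonzero singletonD)

lemma complex_units_simps [simp]:
  "z \<in> carrier complex_units \<longleftrightarrow> z \<noteq> 0"
  "x \<otimes>\<^bsub>complex_units\<^esub> y = x * y"
  "\<one>\<^bsub>complex_units\<^esub> = 1"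
  by (simp_all add: complex_units_def)

lemma inv_complex_units [simp]: "z \<noteq> 0 \<Longrightarrow> inv\<^bsub>complex_units\<^esub> z = inverse z"
  using comm_group_complex_units
  by (intro group.inv_equality) (auto simp: comm_group_def)

text \<open>The first pair is the second one times the coboundary of \<open>h\<close>, multiplied
  out to avoid inverses. Only values on the carrier are compared, so the functions may be
  non-extensional.\<close>

definition cohomologous ::
  "('q, 'm) ring_scheme \<Rightarrow> ('q \<times> 'q \<Rightarrow> complex) \<Rightarrow> ('q \<times> 'q \<Rightarrow> complex) \<Rightarrow>
    ('q \<times> 'q \<Rightarrow> complex) \<Rightarrow> ('q \<times> 'q \<Rightarrow> complex) \<Rightarrow> bool" where
  "cohomologous Q \<alpha> \<mu> \<beta> \<nu> \<longleftrightarrow> (\<exists>h. h \<zero>\<^bsub>Q\<^esub> = 1 \<and> (\<forall>x \<in> carrier Q. h x \<noteq> 0) \<and>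
     (\<forall>x \<in> carrier Q. \<forall>y \<in> carrier Q.
        \<alpha> (x, y) * h (x \<oplus>\<^bsub>Q\<^esub> y) = h x * h y * \<beta> (x, y) \<and>
        \<mu> (x, y) * h (x \<otimes>\<^bsub>Q\<^esub> y) = h x * h y * \<nu> (x, y)))"

lemma cohomologousI:
  assumes "h \<zero>\<^bsub>Q\<^esub> = 1" "\<And>x. x \<in> carrier Q \<Longrightarrow> h x \<noteq> 0"
    "\<And>x y. \<lbrakk>x \<in> carrier Q; y \<in> carrier Q\<rbrakk> \<Longrightarrow> \<alpha> (x, y) * h (x \<oplus>\<^bsub>Q\<^esub> y) = h x * h y * \<beta> (x, y)"
    "\<And>x y. \<lbrakk>x \<in> carrier Q; y \<in> carrier Q\<rbrakk> \<Longrightarrow> \<mu> (x, y) * h (x \<otimes>\<^bsub>Q\<^esub> y) = h x * h y * \<nu> (x, y)"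
  shows "cohomologous Q \<alpha> \<mu> \<beta> \<nu>"
  using assms unfolding cohomologous_def by blast

lemma cohomologousE:
  assumes "cohomologous Q \<alpha> \<mu> \<beta> \<nu>"
  obtains h where "h \<zero>\<^bsub>Q\<^esub> = 1" "\<And>x. x \<in> carrier Q \<Longrightarrow> h x \<noteq> 0"
    "\<And>x y. \<lbrakk>x \<in> carrier Q; y \<in> carrier Q\<rbrakk> \<Longrightarrow> \<alpha> (x, y) * h (x \<oplus>\<^bsub>Q\<^esub> y) = h x * h y * \<beta> (x, y)"
    "\<And>x y. \<lbrakk>x \<in> carrier Q; y \<in> carrier Q\<rbrakk> \<Longrightarrow> \<mu> (x, y) * h (x \<otimes>\<^bsub>Q\<^esub> y) = h x * h y * \<nu> (x, y)"
  using assms unfolding cohomologous_def by blast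

lemma cohomologous_refl: "cohomologous Q \<alpha> \<mu> \<alpha> \<mu>"
  by (rule cohomologousI[where h = "\<lambda>x. 1"]) simp_all

context skew_brace
begin

lemma cohomologous_sym:
  assumes "cohomologous A \<alpha> \<mu> \<beta> \<nu>"
  shows "cohomologous A \<beta> \<nu> \<alpha> \<mu>"
proof -
  obtain h where h: "h \<zero> = 1" "\<And>x. x \<in> carrier A \<Longrightarrow> h x \<noteq> 0"
    "\<And>x y. \<lbrakk>x \<in> carrier A; y \<in> carrier A\<rbrakk> \<Longrightarrow> \<alpha> (x, y) * h (x \<oplus> y) = h x * h y * \<beta> (x, y)"
    "\<And>x y. \<lbrakk>x \<in> carrier A; y \<in> carrier A\<rbrakk> \<Longrightarrow> \<mu> (x, y) * h (x \<otimes> y) = h x * h y * \<nu> (x, y)"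
    using assms by (rule cohomologousE) (rule that)
  show ?thesis
    by (rule cohomologousI[where h = "\<lambda>x. inverse (h x)"]) (use h in \<open>simp_all add: field_simps\<close>)
qed

lemma cohomologous_trans:
  assumes "cohomologous A \<alpha> \<mu> \<beta> \<nu>" "cohomologous A \<beta> \<nu> \<gamma> \<kappa>"
  shows "cohomologous A \<alpha> \<mu> \<gamma> \<kappa>"
proof -
  obtain h where h: "h \<zero> = 1" "\<And>x. x \<in> carrier A \<Longrightarrow> h x \<noteq> 0"
    "\<And>x y. \<lbrakk>x \<in> carrier A; y \<in> carrier A\<rbrakk> \<Longrightarrow> \<alpha> (x, y) * h (x \<oplus> y) = h x * h y * \<beta> (x, y)"
    "\<And>x y. \<lbrakk>x \<in> carrier A; y \<in> carrier A\<rbrakk> \<Longrightarrow> \<mu> (x, y) * h (x \<otimes> y) = h x * h y * \<nu> (x, y)"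
    using assms(1) by (rule cohomologousE) (rule that)
  obtain k where k: "k \<zero> = 1" "\<And>x. x \<in> carrier A \<Longrightarrow> k x \<noteq> 0"
    "\<And>x y. \<lbrakk>x \<in> carrier A; y \<in> carrier A\<rbrakk> \<Longrightarrow> \<beta> (x, y) * k (x \<oplus> y) = k x * k y * \<gamma> (x, y)"
    "\<And>x y. \<lbrakk>x \<in> carrier A; y \<in> carrier A\<rbrakk> \<Longrightarrow> \<nu> (x, y) * k (x \<otimes> y) = k x * k y * \<kappa> (x, y)"
    using assms(2) by (rule cohomologousE) (rule that)
  show ?thesis
  proof (rule cohomologousI[where h = "\<lambda>x. h x * k x"])
    fix x y assume xy: "x \<in> carrier A" "y \<in> carrier A"
    have "\<alpha> (x, y) * (h (x \<oplus> y) * k (x \<oplus> y)) = h x * h y * (\<beta> (x, y) * k (x \<oplus> y))"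
      using h(3)[OF xy] by (simp add: mult_ac)
    also have "\<dots> = h x * k x * (h y * k y) * \<gamma> (x, y)"
      using k(3)[OF xy] by (simp add: mult_ac)
    finally show "\<alpha> (x, y) * (h (x \<oplus> y) * k (x \<oplus> y)) = h x * k x * (h y * k y) * \<gamma> (x, y)" .
    have "\<mu> (x, y) * (h (x \<otimes> y) * k (x \<otimes> y)) = h x * h y * (\<nu> (x, y) * k (x \<otimes> y))"
      using h(4)[OF xy] by (simp add: mult_ac)
    also have "\<dots> = h x * k x * (h y * k y) * \<kappa> (x, y)"
      using k(4)[OF xy] by (simp add: mult_ac)
    finally show "\<mu> (x, y) * (h (x \<otimes> y) * k (x \<otimes> y)) = h x * k x * (h y * k y) * \<kappa> (x, y)" .
  qed (use h k in auto)
qed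

text \<open>This translates classes in \<open>H2b\<close> into the relation
  \<open>cohomologous\<close>. Extensionality appears because the product in \<open>Z2b\<close>
  restricts its results to the carrier.\<close>

lemma mem_B2b_coset_iff:
  "(\<alpha>, \<mu>) \<in> B2b A complex_units #>\<^bsub>Z2b A complex_units\<^esub> (\<beta>, \<nu>) \<longleftrightarrow>
    \<alpha> \<in> extensional (carrier A \<times> carrier A) \<and> \<mu> \<in> extensional (carrier A \<times> carrier A) \<and>
    cohomologous A \<alpha> \<mu> \<beta> \<nu>" (is "?L \<longleftrightarrow> ?R")
proof
  assume ?L
  then obtain h where h: "h \<in> carrier A \<rightarrow> carrier complex_units" "h \<zero> = 1"
    and eq: "\<alpha> = (\<lambda>u\<in>carrier A \<times> carrier A. coboundary (add_monoid A) complex_units h u * \<beta> u)"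
      "\<mu> = (\<lambda>u\<in>carrier A \<times> carrier A. coboundary A complex_units h u * \<nu> u)"
    by (auto simp: r_coset_def B2b_def Z2b_def)
  have nz: "h x \<noteq> 0" if "x \<in> carrier A" for x
    using h that by (simp add: Pi_iff)
  have "cohomologous A \<alpha> \<mu> \<beta> \<nu>"
    by (rule cohomologousI[where h = h]) (use h nz in \<open>simp_all add: eq coboundary_def field_simps\<close>)
  then show ?R
    by (simp add: eq)
next
  assume R: ?R
  then obtain h where h: "h \<zero> = 1" "\<And>x. x \<in> carrier A \<Longrightarrow> h x \<noteq> 0"
    "\<And>x y. \<lbrakk>x \<in> carrier A; y \<in> carrier A\<rbrakk> \<Longrightarrow> \<alpha> (x, y) * h (x \<oplus> y) = h x * h y * \<beta> (x, y)"
    "\<And>x y. \<lbrakk>x \<in> carrier A; y \<in> carrier A\<rbrakk> \<Longrightarrow> \<mu> (x, y) * h (x \<otimes> y) = h x * h y * \<nu> (x, y)"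
    by (elim conjE cohomologousE) (rule that)
  have "\<alpha> = (\<lambda>u\<in>carrier A \<times> carrier A. coboundary (add_monoid A) complex_units h u * \<beta> u)"
    by (rule extensionalityI[of _ "carrier A \<times> carrier A"])
      (use R h in \<open>auto simp: coboundary_def field_simps\<close>)
  moreover have "\<mu> = (\<lambda>u\<in>carrier A \<times> carrier A. coboundary A complex_units h u * \<nu> u)"
    by (rule extensionalityI[of _ "carrier A \<times> carrier A"])
      (use R h in \<open>auto simp: coboundary_def field_simps\<close>)
  moreover have "(coboundary (add_monoid A) complex_units h, coboundary A complex_units h)
      \<in> B2b A complex_units"
    using h by (auto simp: B2b_def)
  ultimately show ?L
    unfolding r_coset_def by (intro UN_I) (auto simp: Z2b_def)
qed

lemma B2b_coset_eq_iff:
  assumes "\<alpha> \<in> extensional (carrier A \<times> carrier A)" "\<mu> \<in> extensional (carrier A \<times> carrier A)"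
  shows "B2b A complex_units #>\<^bsub>Z2b A complex_units\<^esub> (\<alpha>, \<mu>) =
      B2b A complex_units #>\<^bsub>Z2b A complex_units\<^esub> (\<beta>, \<nu>) \<longleftrightarrow> cohomologous A \<alpha> \<mu> \<beta> \<nu>"
    (is "?L \<longleftrightarrow> ?R")
proof
  assume ?L
  then show ?R
    using assms cohomologous_refl mem_B2b_coset_iff by blast
next
  assume ?R
  then have "cohomologous A \<gamma> \<kappa> \<alpha> \<mu> \<longleftrightarrow> cohomologous A \<gamma> \<kappa> \<beta> \<nu>" for \<gamma> \<kappa>
    using cohomologous_sym cohomologous_trans by blast
  then show ?L
    by (auto simp: mem_B2b_coset_iff set_eq_iff)
qed

text \<open>Since the values are nonzero, the inverses in the cocycle conditions can be cleared,
  which leaves polynomial identities.\<close>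

lemma factor_set_complex_units_iff:
  "factor_set A complex_units \<alpha> \<mu> \<longleftrightarrow>
    (\<forall>x \<in> carrier A. \<forall>y \<in> carrier A. \<alpha> (x, y) \<noteq> 0 \<and> \<mu> (x, y) \<noteq> 0) \<and>
    (\<forall>x \<in> carrier A. \<alpha> (\<zero>, x) = 1 \<and> \<alpha> (x, \<zero>) = 1 \<and> \<mu> (\<zero>, x) = 1 \<and> \<mu> (x, \<zero>) = 1) \<and>
    (\<forall>x \<in> carrier A. \<forall>y \<in> carrier A. \<forall>z \<in> carrier A.
      \<alpha> (x, y) * \<alpha> (x \<oplus> y, z) = \<alpha> (y, z) * \<alpha> (x, y \<oplus> z) \<and>
      \<mu> (x, y) * \<mu> (x \<otimes> y, z) = \<mu> (y, z) * \<mu> (x, y \<otimes> z) \<and>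
      \<alpha> (y, z) * \<mu> (x, y \<oplus> z) * \<alpha> (\<ominus> x, x) =
        \<mu> (x, z) * \<alpha> (x \<otimes> y, \<ominus> x) * \<alpha> ((x \<otimes> y) \<ominus> x, x \<otimes> z) * \<mu> (x, y))"
proof -
  have cancel: "a * inverse b * c * inverse d = 1 \<longleftrightarrow> d * b = a * c"
    if "b \<noteq> 0" "d \<noteq> 0" for a b c d :: complex
    using that by (auto simp: field_simps)
  have pi: "\<gamma> \<in> carrier A \<times> carrier A \<rightarrow> carrier complex_units \<longleftrightarrow>
      (\<forall>x \<in> carrier A. \<forall>y \<in> carrier A. \<gamma> (x, y) \<noteq> 0)" for \<gamma> :: "'a \<times> 'a \<Rightarrow> complex"
    by auto
  show ?thesis
  proof (cases "\<forall>x \<in> carrier A. \<forall>y \<in> carrier A. \<alpha> (x, y) \<noteq> 0 \<and> \<mu> (x, y) \<noteq> 0")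
    case True
    then show ?thesis
      unfolding factor_set_def pi by (simp add: cancel cong: ball_cong) blast
  qed (auto simp: factor_set_def pi)
qed

section \<open>Finiteness of the Schur multiplier by averaging over the additive group\<close>

lemma prod_translate:
  assumes "x \<in> carrier A"
  shows "(\<Prod>z\<in>carrier A. f (x \<oplus> z)) = (\<Prod>z\<in>carrier A. f z :: complex)"
proof (rule prod.reindex_bij_betw)
  show "bij_betw ((\<oplus>) x) (carrier A) (carrier A)"
    by (rule bij_betw_byWitness[where f' = "\<lambda>z. \<ominus> x \<oplus> z"])
      (use assms in \<open>auto simp flip: add.m_assoc\<close>)
qed

text \<open>
  Averaging a factor set over the additive group: \<open>\<alpha>\<^sup>n\<close> is the additive coboundary of
  \<open>w x = (\<Prod>z. \<alpha> (x, z))\<close>, and dividing \<open>\<mu>\<^sup>n\<close> by the circle coboundary of \<open>w\<close> leaves a map that is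
  additive in its second argument.
\<close>

lemma factor_set_cohomologous_roots_of_unity:
  assumes fin: "finite (carrier A)" and fs: "factor_set A complex_units \<alpha> \<mu>"
  obtains \<beta> \<nu> where "cohomologous A \<alpha> \<mu> \<beta> \<nu>"
    "\<And>x y. \<lbrakk>x \<in> carrier A; y \<in> carrier A\<rbrakk> \<Longrightarrow>
      \<beta> (x, y) ^ (card (carrier A) * card (carrier A)) = 1 \<and>
      \<nu> (x, y) ^ (card (carrier A) * card (carrier A)) = 1"
proof -
  define n where "n = card (carrier A)"
  have n: "n > 0"
    unfolding n_def using fin add.one_closed by (auto simp: card_gt_0_iff)
  have nz: "\<alpha> (x, y) \<noteq> 0" "\<mu> (x, y) \<noteq> 0" if "x \<in> carrier A" "y \<in> carrier A" for x y
    using fs that by (auto simp: factor_set_complex_units_iff)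
  define w where "w x = (\<Prod>z\<in>carrier A. \<alpha> (x, z))" for x
  have w_nz: "w x \<noteq> 0" if "x \<in> carrier A" for x
    using that nz fin by (simp add: w_def)
  have w_zero: "w \<zero> = 1"
    using fs by (simp add: w_def factor_set_complex_units_iff)
  have alpha_pow: "\<alpha> (x, y) ^ n * w (x \<oplus> y) = w x * w y" if "x \<in> carrier A" "y \<in> carrier A" for x y
  proof -
    have "\<alpha> (x, y) ^ n * w (x \<oplus> y) = (\<Prod>z\<in>carrier A. \<alpha> (x, y) * \<alpha> (x \<oplus> y, z))"
      by (simp add: w_def prod.distrib n_def)
    also have "\<dots> = (\<Prod>z\<in>carrier A. \<alpha> (y, z) * \<alpha> (x, y \<oplus> z))"
      using fs that by (intro prod.cong) (auto simp: factor_set_complex_units_iff)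
    also have "\<dots> = w x * w y"
      using prod_translate[OF that(2), of "\<lambda>z. \<alpha> (x, z)"] by (simp add: w_def prod.distrib mult.commute)
    finally show ?thesis .
  qed
  \<comment> \<open>An \<open>n\<close>-th root of \<open>w\<close> is chosen pointwise. At \<zero>
    the root 1 is prescribed, because the function defining a coboundary must be normalized.\<close>
  have "\<exists>r. r ^ n = w x \<and> (x = \<zero> \<longrightarrow> r = 1)" if "x \<in> carrier A" for x
  proof (cases "x = \<zero>")
    case False
    have "card {r. r ^ n = w x} = n"
      using w_nz[OF that] n by (rule card_nth_roots)
    then show ?thesis
      using False n by (cases "{r. r ^ n = w x} = {}") auto
  qed (use w_zero in auto)
  then obtain h where h_pow: "\<And>x. x \<in> carrier A \<Longrightarrow> h x ^ n = w x" and h_zero: "h \<zero> = 1"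
    by (metis add.one_closed)
  have h_nz: "h x \<noteq> 0" if "x \<in> carrier A" for x
    using h_pow[OF that] w_nz[OF that] n by (auto simp: power_0_left)
  \<comment> \<open>Dividing by the coboundary of \<open>h\<close> divides \<open>n\<close>-th
    powers by the coboundary of \<open>w\<close>. This already gives
    \<open>\<beta> (x, y) ^ n = 1\<close>; for \<nu> a second exponent \<open>n\<close> is
    needed.\<close>
  define \<beta> where "\<beta> = (\<lambda>(x, y). \<alpha> (x, y) * h (x \<oplus> y) / (h x * h y))"
  define \<nu> where "\<nu> = (\<lambda>(x, y). \<mu> (x, y) * h (x \<otimes> y) / (h x * h y))"
  have "cohomologous A \<alpha> \<mu> \<beta> \<nu>"
    by (rule cohomologousI[where h = h]) (use h_zero h_nz in \<open>simp_all add: \<beta>_def \<nu>_def\<close>)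
  moreover have "\<beta> (x, y) ^ (n * n) = 1 \<and> \<nu> (x, y) ^ (n * n) = 1" if x: "x \<in> carrier A" and y: "y \<in> carrier A" for x y
  proof -
    have "\<beta> (x, y) ^ n = 1"
      using alpha_pow[OF x y] x y w_nz by (simp add: \<beta>_def power_mult_distrib power_divide h_pow)
    moreover have "(\<nu> (x, y) ^ n) ^ n = 1"
    proof -
      define \<kappa> where "\<kappa> z = \<nu> (x, z) ^ n" for z
      have kappa: "\<mu> (x, z) ^ n = \<kappa> z * (w x * w z / w (x \<otimes> z))" if "z \<in> carrier A" for z
        using that x w_nz by (simp add: \<kappa>_def \<nu>_def power_mult_distrib power_divide h_pow)
      have alpha_pow': "\<alpha> (a, b) ^ n = w a * w b / w (a \<oplus> b)" if "a \<in> carrier A" "b \<in> carrier A" for a b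
        using alpha_pow[OF that] w_nz that by (simp add: field_simps)
      \<comment> \<open>In the \<open>n\<close>-th power of the brace identity, powers of \<alpha>
        are expressed through \<open>w\<close> and those of \<mu> through \<open>\<kappa>\<close>
        and \<open>w\<close>. All factors \<open>w\<close> cancel, and \<open>\<kappa>\<close> turns
        sums into products.\<close>
      have kappa_add: "\<kappa> (y \<oplus> z) = \<kappa> y * \<kappa> z" if z: "z \<in> carrier A" for z
      proof -
        have xy: "x \<otimes> y \<ominus> x \<in> carrier A"
          using x y by (simp add: a_minus_def)
        have "(\<alpha> (y, z) * \<mu> (x, y \<oplus> z) * \<alpha> (\<ominus> x, x)) ^ n =
            (\<mu> (x, z) * \<alpha> (x \<otimes> y, \<ominus> x) * \<alpha> ((x \<otimes> y) \<ominus> x, x \<otimes> z) * \<mu> (x, y)) ^ n"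
          using fs x y z by (simp add: factor_set_complex_units_iff)
        then have "w y * w z / w (y \<oplus> z) * (\<kappa> (y \<oplus> z) * (w x * w (y \<oplus> z) / w (x \<otimes> (y \<oplus> z)))) *
              (w (\<ominus> x) * w x / w \<zero>) =
            \<kappa> z * (w x * w z / w (x \<otimes> z)) * (w (x \<otimes> y) * w (\<ominus> x) / w ((x \<otimes> y) \<ominus> x)) *
              (w ((x \<otimes> y) \<ominus> x) * w (x \<otimes> z) / w (x \<otimes> (y \<oplus> z))) *
              (\<kappa> y * (w x * w y / w (x \<otimes> y)))"
          using x y z xy by (simp add: power_mult_distrib alpha_pow' kappa circ_add a_minus_def)
        moreover have "w a \<noteq> 0" if "a \<in> {x, y, z, \<ominus> x, x \<otimes> y, x \<otimes> z, y \<oplus> z, x \<otimes> y \<ominus> x, x \<otimes> (y \<oplus> z)}" for a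
          using that x y z xy w_nz by auto
        ultimately show ?thesis
          by (simp add: w_zero field_simps)
      qed
      have kappa_nz: "\<kappa> z \<noteq> 0" if "z \<in> carrier A" for z
        using that x nz h_nz by (simp add: \<kappa>_def \<nu>_def)
      \<comment> \<open>Translation by \<open>y\<close> permutes the factors of the product and
        multiplies it by \<open>\<kappa> y ^ n\<close>, which must therefore be 1.\<close>
      have "(\<Prod>z\<in>carrier A. \<kappa> z) = (\<Prod>z\<in>carrier A. \<kappa> (y \<oplus> z))"
        using prod_translate[OF y] by simp
      also have "\<dots> = \<kappa> y ^ n * (\<Prod>z\<in>carrier A. \<kappa> z)"
        by (simp add: kappa_add prod.distrib n_def)
      finally have "\<kappa> y ^ n = 1"
        using kappa_nz fin by simp
      then show ?thesis
        by (simp add: \<kappa>_def)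
    qed
    ultimately show ?thesis
      by (simp add: power_mult)
  qed
  ultimately show thesis
    using that unfolding n_def by blast
qed

lemma carrier_schur_multiplier:
  "carrier (schur_multiplier A) =
    (\<lambda>c. B2b A complex_units #>\<^bsub>Z2b A complex_units\<^esub> c) ` carrier (Z2b A complex_units)"
  by (auto simp: schur_multiplier_def H2b_def FactGroup_def RCOSETS_def)

text \<open>Every class has a representative whose values are roots of unity of one fixed exponent,
  and only finitely many extensional pairs have such values.\<close>

lemma finite_schur_multiplier:
  assumes "finite (carrier A)"
  shows "finite (carrier (schur_multiplier A))"
proof -
  let ?C = "carrier A \<times> carrier A"
  let ?R = "?C \<rightarrow>\<^sub>E {z :: complex. z ^ (card (carrier A) * card (carrier A)) = 1}"
  have "card (carrier A) > 0"
    using assms add.one_closed by (auto simp: card_gt_0_iff)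
  then have "finite ?R"
    using assms by (intro finite_PiE finite_nth_roots) auto
  moreover have "carrier (schur_multiplier A) \<subseteq>
      (\<lambda>c. B2b A complex_units #>\<^bsub>Z2b A complex_units\<^esub> c) ` (?R \<times> ?R)"
  proof
    fix X assume "X \<in> carrier (schur_multiplier A)"
    then obtain \<alpha> \<mu> where X: "X = B2b A complex_units #>\<^bsub>Z2b A complex_units\<^esub> (\<alpha>, \<mu>)"
      and fs: "factor_set A complex_units \<alpha> \<mu>" and ext: "\<alpha> \<in> extensional ?C" "\<mu> \<in> extensional ?C"
      by (auto simp: carrier_schur_multiplier Z2b_def)
    obtain \<beta> \<nu> where coh: "cohomologous A \<alpha> \<mu> \<beta> \<nu>"
      and roots: "\<And>x y. \<lbrakk>x \<in> carrier A; y \<in> carrier A\<rbrakk> \<Longrightarrow>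
      \<beta> (x, y) ^ (card (carrier A) * card (carrier A)) = 1 \<and>
      \<nu> (x, y) ^ (card (carrier A) * card (carrier A)) = 1"
      using factor_set_cohomologous_roots_of_unity[OF assms fs] by blast
    have "cohomologous A \<alpha> \<mu> (restrict \<beta> ?C) (restrict \<nu> ?C)"
      using coh by (simp add: cohomologous_def)
    then have "X = B2b A complex_units #>\<^bsub>Z2b A complex_units\<^esub> (restrict \<beta> ?C, restrict \<nu> ?C)"
      using B2b_coset_eq_iff[OF ext] X by blast
    moreover have "restrict \<beta> ?C \<in> ?R" "restrict \<nu> ?C \<in> ?R"
      using roots by auto
    ultimately show "X \<in> (\<lambda>c. B2b A complex_units #>\<^bsub>Z2b A complex_units\<^esub> c) ` (?R \<times> ?R)"
      by blast
  qed
  ultimately show ?thesis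
    by (meson finite_SigmaI finite_imageI finite_subset)
qed

end

text \<open>The constant pair 1 is a factor set. Positivity matters because \<open>card\<close> is 0
  on infinite sets: it makes a kernel of the same cardinality finite.\<close>

lemma (in skew_brace) card_schur_multiplier_pos:
  assumes "finite (carrier A)"
  shows "card (carrier (schur_multiplier A)) > 0"
proof -
  have "(\<lambda>_\<in>carrier A \<times> carrier A. 1, \<lambda>_\<in>carrier A \<times> carrier A. 1) \<in> carrier (Z2b A complex_units)"
    by (simp add: Z2b_def factor_set_complex_units_iff a_minus_def)
  then show ?thesis
    using finite_schur_multiplier[OF assms] by (auto simp: card_gt_0_iff carrier_schur_multiplier)
qed

section \<open>Commutators and annihilators\<close>

context skew_brace
begin

lemma subgroup_commutator: "subgroup (commutator A) (add_monoid A)"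
  unfolding commutator_def
  by (rule group.generate_is_subgroup[OF add_group])
    (auto simp: add_commutator_def star_def a_minus_def)

lemma commutator_closed:
  "\<zero> \<in> commutator A"
  "x \<in> commutator A \<Longrightarrow> x \<in> carrier A"
  "x \<in> commutator A \<Longrightarrow> \<ominus> x \<in> commutator A"
  "\<lbrakk>x \<in> commutator A; y \<in> commutator A\<rbrakk> \<Longrightarrow> x \<oplus> y \<in> commutator A"
  using subgroup.one_closed[OF subgroup_commutator] subgroup.mem_carrier[OF subgroup_commutator]
    subgroup.m_inv_closed[OF subgroup_commutator] subgroup.m_closed[OF subgroup_commutator]
  by (simp_all add: a_inv_def)

lemma add_commutator_in_commutator:
  "\<lbrakk>a \<in> carrier A; b \<in> carrier A\<rbrakk> \<Longrightarrow> add_commutator A a b \<in> commutator A"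
  unfolding commutator_def by (intro generate.incl) blast

lemma star_in_commutator:
  "\<lbrakk>a \<in> carrier A; b \<in> carrier A\<rbrakk> \<Longrightarrow> star A a b \<in> commutator A"
  unfolding commutator_def by (intro generate.incl) blast

text \<open>The circle operation is recovered from addition and \<open>star\<close>; hence the
  additive subgroup \<open>commutator A\<close> is also closed under the circle operation.\<close>

lemma circ_eq_star:
  assumes "a \<in> carrier A" "b \<in> carrier A"
  shows "a \<otimes> b = a \<oplus> star A a b \<oplus> b"
  using assms by (simp add: star_def a_minus_def add.m_assoc) (simp flip: add.m_assoc)

lemma commutator_circ_closed:
  "\<lbrakk>x \<in> commutator A; y \<in> commutator A\<rbrakk> \<Longrightarrow> x \<otimes> y \<in> commutator A"
  by (simp add: circ_eq_star commutator_closed star_in_commutator)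

lemma commutator_induct [consumes 1, case_names zero add_commutator star minus add]:
  assumes "x \<in> commutator A"
    and "P \<zero>"
    and "\<And>a b. \<lbrakk>a \<in> carrier A; b \<in> carrier A\<rbrakk> \<Longrightarrow> P (add_commutator A a b)"
    and "\<And>a b. \<lbrakk>a \<in> carrier A; b \<in> carrier A\<rbrakk> \<Longrightarrow> P (star A a b)"
    and minus: "\<And>x. \<lbrakk>x \<in> commutator A; P x\<rbrakk> \<Longrightarrow> P (\<ominus> x)"
    and add: "\<And>x y. \<lbrakk>x \<in> commutator A; y \<in> commutator A; P x; P y\<rbrakk> \<Longrightarrow> P (x \<oplus> y)"
  shows "P x"
  using assms(1) unfolding commutator_def
proof (induction rule: generate.induct)
  case (inv h)
  then have "h \<in> commutator A" "P h"
    using assms(3,4) add_commutator_in_commutator star_in_commutator by auto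
  then show ?case
    using minus by (simp add: a_inv_def)
next
  case (eng x y)
  then show ?case
    using add by (simp add: commutator_def)
qed (use assms(2-4) in auto)

text \<open>\<open>star A a b\<close> vanishes exactly when both operations agree on
  \<open>a\<close> and \<open>b\<close>; with both orders vanishing and \<open>a\<close> additively
  central, \<open>a\<close> is also central for the circle operation. In this form membership can be
  transported along homomorphisms.\<close>

lemma mem_annihilator_iff:
  "a \<in> annihilator A \<longleftrightarrow> a \<in> carrier A \<and>
    (\<forall>b \<in> carrier A. add_commutator A a b = \<zero> \<and> star A a b = \<zero> \<and> star A b a = \<zero>)"
proof -
  have minus: "x \<ominus> y = \<zero> \<longleftrightarrow> x = y" if "x \<in> carrier A" "y \<in> carrier A" for x y
    using that unfolding a_minus_def by (metis add.inv_closed add.inv_equality add.inv_inv add.r_inv)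
  have "add_commutator A a b = \<zero> \<longleftrightarrow> a \<oplus> b = b \<oplus> a" if "a \<in> carrier A" "b \<in> carrier A" for b
    using that minus[of "a \<oplus> b \<ominus> a" b] unfolding add_commutator_def a_minus_def
    by (metis add.inv_closed add.inv_solve_right add.m_closed)
  moreover have "star A x y = \<zero> \<longleftrightarrow> (\<ominus> x) \<oplus> (x \<otimes> y) = y" if "x \<in> carrier A" "y \<in> carrier A" for x y
    using that by (simp add: star_def minus)
  moreover have "(\<ominus> x) \<oplus> (x \<otimes> y) = y \<longleftrightarrow> x \<otimes> y = x \<oplus> y" if "x \<in> carrier A" "y \<in> carrier A" for x y
    using that by (metis add.inv_solve_left circ.m_closed)
  ultimately have iff: "add_commutator A a b = \<zero> \<and> star A a b = \<zero> \<and> star A b a = \<zero> \<longleftrightarrow>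
      (\<ominus> a) \<oplus> (a \<otimes> b) = b \<and> a \<oplus> b = b \<oplus> a \<and> a \<otimes> b = b \<otimes> a"
    if "a \<in> carrier A" "b \<in> carrier A" for b
    using that by metis
  show ?thesis
    unfolding annihilator_def using iff by blast
qed

lemma annihilator_add_closed:
  assumes "z \<in> annihilator A" "w \<in> annihilator A"
  shows "z \<oplus> w \<in> annihilator A"
proof -
  note z = assms(1)
  have w: "w \<in> carrier A"
    using assms(2) by (rule annihilatorD)
  have "add_commutator A (z \<oplus> w) b = add_commutator A w b" "star A (z \<oplus> w) b = star A w b"
    "star A b (z \<oplus> w) = star A b w" if "b \<in> carrier A" for b
    using that w add_commutator_annihilator[OF z zero_in_annihilator w, of b]
      star_annihilator[OF z zero_in_annihilator w, of b]
      star_annihilator[OF zero_in_annihilator z _ w, of b]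
    by simp_all
  then show ?thesis
    using assms(2) annihilatorD(1)[OF z] w by (simp add: mem_annihilator_iff)
qed

text \<open>
  The quotient of two maps with the same defects \<open>c\<close> and \<open>d\<close> is a homomorphism for both operations
  into an abelian group.
\<close>

lemma eq_on_commutator:
  fixes u v :: "'a \<Rightarrow> complex"
  assumes u: "\<And>a. a \<in> carrier A \<Longrightarrow> u a \<noteq> 0"
    "\<And>a b. \<lbrakk>a \<in> carrier A; b \<in> carrier A\<rbrakk> \<Longrightarrow> u (a \<oplus> b) = u a * u b * c a b"
    "\<And>a b. \<lbrakk>a \<in> carrier A; b \<in> carrier A\<rbrakk> \<Longrightarrow> u (a \<otimes> b) = u a * u b * d a b"
    and v: "\<And>a. a \<in> carrier A \<Longrightarrow> v a \<noteq> 0"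
    "\<And>a b. \<lbrakk>a \<in> carrier A; b \<in> carrier A\<rbrakk> \<Longrightarrow> v (a \<oplus> b) = v a * v b * c a b"
    "\<And>a b. \<lbrakk>a \<in> carrier A; b \<in> carrier A\<rbrakk> \<Longrightarrow> v (a \<otimes> b) = v a * v b * d a b"
    and x: "x \<in> commutator A"
  shows "u x = v x"
proof -
  define r where "r a = u a / v a" for a
  have r_nz: "r a \<noteq> 0" if "a \<in> carrier A" for a
    using that u v by (simp add: r_def)
  have r_add: "r (a \<oplus> b) = r a * r b" if "a \<in> carrier A" "b \<in> carrier A" for a b
  proof -
    have "c a b \<noteq> 0"
      using that u(1)[of "a \<oplus> b"] u(2) by auto
    then show ?thesis
      using that u v by (simp add: r_def)
  qed
  have r_circ: "r (a \<otimes> b) = r a * r b" if "a \<in> carrier A" "b \<in> carrier A" for a b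
  proof -
    have "d a b \<noteq> 0"
      using that u(1)[of "a \<otimes> b"] u(3) by auto
    then show ?thesis
      using that u v by (simp add: r_def)
  qed
  have r_zero: "r \<zero> = 1"
    using r_add[of \<zero> \<zero>] r_nz[of \<zero>] by simp
  have r_minus: "r (\<ominus> a) = inverse (r a)" if "a \<in> carrier A" for a
    using r_add[of "\<ominus> a" a] r_nz[of a] r_zero that by (simp add: field_simps)
  have "r x = 1"
    using x
  proof (induction rule: commutator_induct)
    case (minus x)
    then show ?case
      by (simp add: r_minus commutator_closed)
  next
    case (add x y)
    then show ?case
      by (simp add: r_add commutator_closed)
  qed (simp_all add: add_commutator_def star_def a_minus_def r_add r_circ r_minus r_zero r_nz field_simps)
  then show ?thesis
    using v x commutator_closed by (simp add: r_def)
qed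

end

section \<open>Homomorphisms of skew braces and their effect on commutators and annihilators\<close>

locale skew_brace_hom = A: skew_brace A + B: skew_brace B
  for A (structure) and B (structure) and f +
  assumes hom: "f \<in> ring_hom A B"
begin

lemma f_closed [simp]: "x \<in> carrier A \<Longrightarrow> f x \<in> carrier B"
  using hom by (rule ring_hom_closed)

lemma f_add [simp]: "\<lbrakk>x \<in> carrier A; y \<in> carrier A\<rbrakk> \<Longrightarrow> f (x \<oplus>\<^bsub>A\<^esub> y) = f x \<oplus>\<^bsub>B\<^esub> f y"
  using hom by (rule ring_hom_add)

lemma f_circ [simp]: "\<lbrakk>x \<in> carrier A; y \<in> carrier A\<rbrakk> \<Longrightarrow> f (x \<otimes>\<^bsub>A\<^esub> y) = f x \<otimes>\<^bsub>B\<^esub> f y"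
  using hom by (rule ring_hom_mult)

lemma f_one [simp]: "f \<one>\<^bsub>A\<^esub> = \<one>\<^bsub>B\<^esub>"
  using hom by (rule ring_hom_one)

lemma f_zero [simp]: "f \<zero>\<^bsub>A\<^esub> = \<zero>\<^bsub>B\<^esub>"
  by (simp only: A.zero_eq_one B.zero_eq_one f_one)

lemma f_minus [simp]: "x \<in> carrier A \<Longrightarrow> f (\<ominus>\<^bsub>A\<^esub> x) = \<ominus>\<^bsub>B\<^esub> f x"
  using f_add[of "\<ominus>\<^bsub>A\<^esub> x" x] by (intro B.add.inv_equality[symmetric]) (simp_all del: f_add)

lemma f_circ_inv: "x \<in> carrier A \<Longrightarrow> f (inv\<^bsub>A\<^esub> x) = inv\<^bsub>B\<^esub> f x"
  using f_circ[of "inv\<^bsub>A\<^esub> x" x] by (intro B.circ.inv_equality[symmetric]) (simp_all del: f_circ)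

lemma f_add_commutator:
  "\<lbrakk>a \<in> carrier A; b \<in> carrier A\<rbrakk> \<Longrightarrow> f (add_commutator A a b) = add_commutator B (f a) (f b)"
  by (simp add: add_commutator_def a_minus_def)

lemma f_star: "\<lbrakk>a \<in> carrier A; b \<in> carrier A\<rbrakk> \<Longrightarrow> f (star A a b) = star B (f a) (f b)"
  by (simp add: star_def a_minus_def)

lemma image_commutator:
  assumes surj: "f ` carrier A = carrier B"
  shows "f ` commutator A = commutator B"
proof (intro equalityI subsetI)
  fix y assume "y \<in> f ` commutator A"
  then obtain x where "x \<in> commutator A" "y = f x"
    by blast
  then show "y \<in> commutator B"
  proof (induction x arbitrary: y rule: A.commutator_induct)
    case (add x y)
    then show ?case
      using A.commutator_closed B.commutator_closed by simp
  qed (simp_all add: f_add_commutator f_star A.commutator_closed B.commutator_closed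
      B.add_commutator_in_commutator B.star_in_commutator)
next
  fix y assume "y \<in> commutator B"
  then show "y \<in> f ` commutator A"
  proof (induction rule: B.commutator_induct)
    case zero
    then show ?case
      using A.commutator_closed(1) f_zero by force
  next
    case (add_commutator a b)
    then obtain a' b' where "a' \<in> carrier A" "b' \<in> carrier A" "a = f a'" "b = f b'"
      using surj by blast
    then show ?case
      by (intro image_eqI[of _ _ "add_commutator A a' b'"])
        (simp_all add: A.add_commutator_in_commutator f_add_commutator)
  next
    case (star a b)
    then obtain a' b' where "a' \<in> carrier A" "b' \<in> carrier A" "a = f a'" "b = f b'"
      using surj by blast
    then show ?case
      by (intro image_eqI[of _ _ "star A a' b'"]) (simp_all add: A.star_in_commutator f_star)
  next
    case (minus x)
    then obtain x' where "x' \<in> commutator A" "x = f x'"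
      by blast
    then show ?case
      by (intro image_eqI[of _ _ "\<ominus>\<^bsub>A\<^esub> x'"]) (simp_all add: A.commutator_closed)
  next
    case (add x y)
    then obtain x' y' where "x' \<in> commutator A" "x = f x'" "y' \<in> commutator A" "y = f y'"
      by blast
    then show ?case
      by (intro image_eqI[of _ _ "x' \<oplus>\<^bsub>A\<^esub> y'"]) (simp_all add: A.commutator_closed)
  qed
qed

text \<open>By surjectivity, the commutators and stars to be tested in \<open>B\<close> are images
  of those of \<open>a\<close> with elements of \<open>A\<close>. The latter lie in
  \<open>commutator A\<close>, where injectivity lets only zero map to zero.\<close>

lemma annihilator_iff:
  assumes surj: "f ` carrier A = carrier B" and inj: "inj_on f (commutator A)" and a: "a \<in> carrier A"
  shows "f a \<in> annihilator B \<longleftrightarrow> a \<in> annihilator A"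
proof -
  have zero: "f x = \<zero>\<^bsub>B\<^esub> \<longleftrightarrow> x = \<zero>\<^bsub>A\<^esub>" if "x \<in> commutator A" for x
    using inj_onD[OF inj, of x "\<zero>\<^bsub>A\<^esub>"] that A.commutator_closed by auto
  have "f a \<in> annihilator B \<longleftrightarrow> (\<forall>b \<in> carrier A. add_commutator B (f a) (f b) = \<zero>\<^bsub>B\<^esub> \<and>
      star B (f a) (f b) = \<zero>\<^bsub>B\<^esub> \<and> star B (f b) (f a) = \<zero>\<^bsub>B\<^esub>)"
    unfolding B.mem_annihilator_iff using a by (simp flip: surj)
  also have "\<dots> \<longleftrightarrow> a \<in> annihilator A"
    unfolding A.mem_annihilator_iff using a
    by (simp add: zero A.add_commutator_in_commutator A.star_in_commutator flip: f_add_commutator f_star)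
  finally show ?thesis .
qed

end

lemma (in skew_brace_hom) inj_on_commutatorI:
  assumes "\<And>x. \<lbrakk>x \<in> commutator A; f x = \<zero>\<^bsub>B\<^esub>\<rbrakk> \<Longrightarrow> x = \<zero>\<^bsub>A\<^esub>"
  shows "inj_on f (commutator A)"
proof (rule inj_onI)
  fix x y assume xy: "x \<in> commutator A" "y \<in> commutator A" and eq: "f x = f y"
  note c = A.commutator_closed(2)[OF xy(1)] A.commutator_closed(2)[OF xy(2)]
  have "x \<oplus>\<^bsub>A\<^esub> (\<ominus>\<^bsub>A\<^esub> y) = \<zero>\<^bsub>A\<^esub>"
    using xy c eq by (intro assms A.commutator_closed) simp_all
  then show "x = y"
    using c by (metis A.add.inv_closed A.add.inv_equality A.add.inv_inv)
qed

section \<open>The quotient of a skew brace by its annihilator\<close>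

context skew_brace
begin

lemma annihilator_coset_eq_iff:
  assumes "a \<in> carrier A" "b \<in> carrier A"
  shows "annihilator A +> a = annihilator A +> b \<longleftrightarrow> (\<exists>z \<in> annihilator A. a = z \<oplus> b)"
proof
  assume "annihilator A +> a = annihilator A +> b"
  moreover have "a \<in> annihilator A +> a"
    using assms zero_in_annihilator by (force simp: coset_annihilator)
  ultimately show "\<exists>z \<in> annihilator A. a = z \<oplus> b"
    using assms by (auto simp: coset_annihilator)
next
  assume "\<exists>z \<in> annihilator A. a = z \<oplus> b"
  then obtain z where z: "z \<in> annihilator A" "a = z \<oplus> b"
    by blast
  \<comment> \<open>Translation by \<open>z\<close> changes neither commutators nor stars and
    carries \<open>\<ominus> z\<close> to \<zero>, so both have the same commutators and
    stars.\<close>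
  have minus: "\<ominus> z \<in> annihilator A"
  proof -
    have c: "z \<in> carrier A" "\<ominus> z \<in> carrier A"
      using z(1) annihilatorD by auto
    have "add_commutator A (\<ominus> z) y = add_commutator A \<zero> y" "star A (\<ominus> z) y = star A \<zero> y"
      "star A y (\<ominus> z) = star A y \<zero>" if "y \<in> carrier A" for y
      using that c add_commutator_annihilator[OF z(1) zero_in_annihilator c(2), of y]
        star_annihilator[OF z(1) zero_in_annihilator c(2), of y]
        star_annihilator[OF zero_in_annihilator z(1) _ c(2), of y]
      by simp_all
    then show ?thesis
      using c zero_in_annihilator by (simp add: mem_annihilator_iff)
  qed
  show "annihilator A +> a = annihilator A +> b"
  proof (intro equalityI subsetI)
    fix x assume "x \<in> annihilator A +> a"
    then obtain w where w: "w \<in> annihilator A" "x = w \<oplus> a"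
      using assms by (auto simp: coset_annihilator)
    then have "x = (w \<oplus> z) \<oplus> b"
      using assms z annihilatorD(1) by (simp add: add.m_assoc)
    then show "x \<in> annihilator A +> b"
      using assms annihilator_add_closed[OF w(1) z(1)] by (auto simp: coset_annihilator)
  next
    fix x assume "x \<in> annihilator A +> b"
    then obtain w where w: "w \<in> annihilator A" "x = w \<oplus> b"
      using assms by (auto simp: coset_annihilator)
    have "b = \<ominus> z \<oplus> a"
      using assms z annihilatorD(1)[OF z(1)] by (simp flip: add.m_assoc)
    then have "x = (w \<oplus> \<ominus> z) \<oplus> a"
      using w assms annihilatorD(1)[OF w(1)] annihilatorD(1)[OF z(1)]
      by (simp only: add.m_assoc add.inv_closed)
    then show "x \<in> annihilator A +> a"
      using assms annihilator_add_closed[OF w(1) minus] by (auto simp: coset_annihilator)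
  qed
qed

lemma carrier_Quot_annihilator:
  "carrier (A Quot annihilator A) = (\<lambda>a. annihilator A +> a) ` carrier A"
  by (auto simp: FactRing_def A_RCOSETS_defs a_r_coset_defs)

lemma one_Quot_annihilator: "\<one>\<^bsub>A Quot annihilator A\<^esub> = annihilator A +> \<one>"
  by (simp add: FactRing_def)

lemma add_Quot_annihilator:
  assumes a: "a \<in> carrier A" and b: "b \<in> carrier A"
  shows "(annihilator A +> a) \<oplus>\<^bsub>A Quot annihilator A\<^esub> (annihilator A +> b) = annihilator A +> (a \<oplus> b)"
proof -
  have eq: "(z \<oplus> a) \<oplus> (w \<oplus> b) = (z \<oplus> w) \<oplus> (a \<oplus> b)" if "z \<in> annihilator A" "w \<in> annihilator A" for z w
  proof -
    note z' = annihilatorD[OF that(1)] and w' = annihilatorD[OF that(2)]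
    have "(z \<oplus> a) \<oplus> (w \<oplus> b) = z \<oplus> ((a \<oplus> w) \<oplus> b)"
      using z'(1) w'(1) a b by (simp add: add.m_assoc)
    also have "\<dots> = z \<oplus> ((w \<oplus> a) \<oplus> b)"
      using w'(2)[OF a] by simp
    also have "\<dots> = (z \<oplus> w) \<oplus> (a \<oplus> b)"
      using z'(1) w'(1) a b by (simp add: add.m_assoc)
    finally show ?thesis .
  qed
  show ?thesis
  proof (intro equalityI subsetI)
    fix x assume "x \<in> (annihilator A +> a) \<oplus>\<^bsub>A Quot annihilator A\<^esub> (annihilator A +> b)"
    then obtain z w where "z \<in> annihilator A" "w \<in> annihilator A" "x = (z \<oplus> a) \<oplus> (w \<oplus> b)"
      using a b by (auto simp: FactRing_def set_add_def' coset_annihilator)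
    then show "x \<in> annihilator A +> (a \<oplus> b)"
      using a b eq annihilator_add_closed by (auto simp: coset_annihilator)
  next
    fix x assume "x \<in> annihilator A +> (a \<oplus> b)"
    then obtain z where z: "z \<in> annihilator A" "x = z \<oplus> (a \<oplus> b)"
      using a b by (auto simp: coset_annihilator)
    then have "x = (z \<oplus> a) \<oplus> (\<zero> \<oplus> b)"
      using a b annihilatorD(1)[OF z(1)] by (simp add: add.m_assoc)
    then show "x \<in> (annihilator A +> a) \<oplus>\<^bsub>A Quot annihilator A\<^esub> (annihilator A +> b)"
      using a b z zero_in_annihilator
      unfolding FactRing_def ring_record_simps set_add_def' coset_annihilator[OF a] coset_annihilator[OF b]
      by blast
  qed
qed

text \<open>The product in \<open>FactRing\<close> is the union of the cosets of all products of
  representatives. Elements of the annihilator can be pulled out of both operations, so these cosets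
  coincide.\<close>

lemma circ_Quot_annihilator:
  assumes a: "a \<in> carrier A" and b: "b \<in> carrier A"
  shows "(annihilator A +> a) \<otimes>\<^bsub>A Quot annihilator A\<^esub> (annihilator A +> b) = annihilator A +> (a \<otimes> b)"
proof -
  have "annihilator A +> ((z \<oplus> a) \<otimes> (w \<oplus> b)) = annihilator A +> (a \<otimes> b)"
    if z: "z \<in> annihilator A" and w: "w \<in> annihilator A" for z w
  proof -
    note z' = annihilatorD[OF z] and w' = annihilatorD[OF w]
    have "(z \<oplus> a) \<otimes> (w \<oplus> b) = (z \<otimes> a) \<otimes> (w \<otimes> b)"
      using z'(4) w'(4) a b by simp
    also have "\<dots> = z \<otimes> (w \<otimes> (a \<otimes> b))"
      using z'(1) w'(1,3) a b by (metis circ.m_assoc circ.m_closed)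
    also have "\<dots> = (z \<oplus> w) \<oplus> (a \<otimes> b)"
      using z'(1,4) w'(1,4) a b by (simp add: add.m_assoc)
    finally show ?thesis
      using annihilator_coset_eq_iff annihilator_add_closed[OF z w] a b z'(1) w'(1)
      by (metis add.m_closed circ.m_closed)
  qed
  then have "annihilator A +> (x \<otimes> y) = annihilator A +> (a \<otimes> b)"
    if "x \<in> annihilator A +> a" "y \<in> annihilator A +> b" for x y
    using that a b by (auto simp only: coset_annihilator)
  moreover have "annihilator A +> a \<noteq> {}" "annihilator A +> b \<noteq> {}"
    using a b zero_in_annihilator by (auto simp: coset_annihilator)
  ultimately have "(\<Union>x \<in> annihilator A +> a. \<Union>y \<in> annihilator A +> b. annihilator A +> (x \<otimes> y)) =
      annihilator A +> (a \<otimes> b)"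
    by (simp cong: SUP_cong)
  then show ?thesis
    by (simp add: FactRing_def rcoset_mult_def)
qed

end

text \<open>The criterion on the right involves only \<open>A\<close>. Two such homomorphisms out of
  \<open>A\<close> therefore identify the same pairs of elements modulo the annihilators of their
  targets.\<close>

lemma (in skew_brace_hom) annihilator_coset_eq_iff:
  assumes surj: "f ` carrier A = carrier B" and inj: "inj_on f (commutator A)"
    and x: "x \<in> carrier A" and y: "y \<in> carrier A"
  shows "annihilator B +>\<^bsub>B\<^esub> f x = annihilator B +>\<^bsub>B\<^esub> f y \<longleftrightarrow> x \<ominus>\<^bsub>A\<^esub> y \<in> annihilator A"
proof -
  have minus_eq: "f x = z \<oplus>\<^bsub>B\<^esub> f y \<longleftrightarrow> z = f x \<ominus>\<^bsub>B\<^esub> f y" if "z \<in> carrier B" for z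
    using that x y B.add.inv_solve_right[of z "f x" "f y"] by (auto simp: a_minus_def)
  have "annihilator B +>\<^bsub>B\<^esub> f x = annihilator B +>\<^bsub>B\<^esub> f y \<longleftrightarrow> f x \<ominus>\<^bsub>B\<^esub> f y \<in> annihilator B"
    using x y minus_eq B.annihilatorD(1) by (auto simp: B.annihilator_coset_eq_iff)
  also have "\<dots> \<longleftrightarrow> x \<ominus>\<^bsub>A\<^esub> y \<in> annihilator A"
    using annihilator_iff[OF surj inj, of "x \<ominus>\<^bsub>A\<^esub> y"] x y by (simp add: a_minus_def)
  finally show ?thesis .
qed

text \<open>Both quotients by the annihilator are copies of that of \<open>A\<close>, and both
  commutators are copies of \<open>commutator A\<close>. The two isomorphisms go through preimages
  in \<open>A\<close>, so they are compatible with commutators and stars.\<close>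

lemma isoclinic_of_common_cover:
  assumes f: "skew_brace_hom A B f" "f ` carrier A = carrier B" "inj_on f (commutator A)"
    and g: "skew_brace_hom A C g" "g ` carrier A = carrier C" "inj_on g (commutator A)"
  shows "isoclinic B C"
proof -
  interpret f: skew_brace_hom A B f by (rule f(1))
  interpret g: skew_brace_hom A C g by (rule g(1))
  let ?cB = "\<lambda>x. annihilator B +>\<^bsub>B\<^esub> f x" and ?cC = "\<lambda>x. annihilator C +>\<^bsub>C\<^esub> g x"
  have coset_eq: "?cB x = ?cB y \<longleftrightarrow> ?cC x = ?cC y" if "x \<in> carrier A" "y \<in> carrier A" for x y
    using f.annihilator_coset_eq_iff[OF f(2,3) that] g.annihilator_coset_eq_iff[OF g(2,3) that] by simp
  \<comment> \<open>A preimage in \<open>A\<close> is chosen, pushed forward along \<open>g\<close>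
    and read modulo the annihilator of \<open>C\<close>; \<open>coset_eq\<close> makes the choice
    irrelevant.\<close>
  define \<xi> where "\<xi> S = ?cC (SOME x. x \<in> carrier A \<and> S = ?cB x)" for S
  have xi: "\<xi> (?cB x) = ?cC x" if "x \<in> carrier A" for x
    unfolding \<xi>_def by (rule someI2[of _ x]) (use that coset_eq in auto)
  define \<theta> where "\<theta> y = g (inv_into (commutator A) f y)" for y
  have theta: "\<theta> (f x) = g x" if "x \<in> commutator A" for x
    using that f(3) by (simp add: \<theta>_def)
  have carrier_B: "carrier (B Quot annihilator B) = ?cB ` carrier A"
    by (simp add: f.B.carrier_Quot_annihilator image_image flip: f(2))
  have carrier_C: "carrier (C Quot annihilator C) = ?cC ` carrier A"
    by (simp add: g.B.carrier_Quot_annihilator image_image flip: g(2))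
  have comm_B: "commutator B = f ` commutator A" and comm_C: "commutator C = g ` commutator A"
    using f.image_commutator[OF f(2)] g.image_commutator[OF g(2)] by simp_all
  have "\<xi> \<in> ring_iso (B Quot annihilator B) (C Quot annihilator C)"
    unfolding ring_iso_def
  proof (intro CollectI conjI ring_hom_memI)
    show "bij_betw \<xi> (carrier (B Quot annihilator B)) (carrier (C Quot annihilator C))"
      unfolding carrier_B carrier_C
    proof (rule bij_betw_imageI)
      show "inj_on \<xi> (?cB ` carrier A)"
      proof (rule inj_onI)
        fix S T assume "S \<in> ?cB ` carrier A" "T \<in> ?cB ` carrier A" and eq: "\<xi> S = \<xi> T"
        then obtain x y where "x \<in> carrier A" "y \<in> carrier A" "S = ?cB x" "T = ?cB y"
          by blast
        then show "S = T"
          using eq by (simp add: xi coset_eq)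
      qed
    qed (simp add: image_image xi)
    show "\<xi> \<one>\<^bsub>B Quot annihilator B\<^esub> = \<one>\<^bsub>C Quot annihilator C\<^esub>"
      using xi[of "\<one>\<^bsub>A\<^esub>"] by (simp add: f.B.one_Quot_annihilator g.B.one_Quot_annihilator)
  next
    fix S assume "S \<in> carrier (B Quot annihilator B)"
    then show "\<xi> S \<in> carrier (C Quot annihilator C)"
      unfolding carrier_B carrier_C by (auto simp: xi)
  next
    fix S T assume "S \<in> carrier (B Quot annihilator B)" "T \<in> carrier (B Quot annihilator B)"
    then obtain x y where xy: "x \<in> carrier A" "y \<in> carrier A" "S = ?cB x" "T = ?cB y"
      unfolding carrier_B by blast
    then show "\<xi> (S \<otimes>\<^bsub>B Quot annihilator B\<^esub> T) = \<xi> S \<otimes>\<^bsub>C Quot annihilator C\<^esub> \<xi> T"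
      using xi[of "x \<otimes>\<^bsub>A\<^esub> y"] by (simp add: xi f.B.circ_Quot_annihilator g.B.circ_Quot_annihilator)
    show "\<xi> (S \<oplus>\<^bsub>B Quot annihilator B\<^esub> T) = \<xi> S \<oplus>\<^bsub>C Quot annihilator C\<^esub> \<xi> T"
      using xy xi[of "x \<oplus>\<^bsub>A\<^esub> y"] by (simp add: xi f.B.add_Quot_annihilator g.B.add_Quot_annihilator)
  qed
  moreover have "\<theta> \<in> ring_iso (B\<lparr>carrier := commutator B\<rparr>) (C\<lparr>carrier := commutator C\<rparr>)"
    unfolding ring_iso_def
  proof (intro CollectI conjI ring_hom_memI)
    have "inj_on \<theta> (commutator B)"
      unfolding comm_B by (rule inj_onI) (use g(3) theta in \<open>auto dest: inj_onD\<close>)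
    then show "bij_betw \<theta> (carrier (B\<lparr>carrier := commutator B\<rparr>)) (carrier (C\<lparr>carrier := commutator C\<rparr>))"
      unfolding bij_betw_def by (simp add: comm_B comm_C image_image theta)
    have "\<one>\<^bsub>A\<^esub> \<in> commutator A"
      using f.A.commutator_closed(1) by (simp add: f.A.zero_eq_one)
    then show "\<theta> \<one>\<^bsub>B\<lparr>carrier := commutator B\<rparr>\<^esub> = \<one>\<^bsub>C\<lparr>carrier := commutator C\<rparr>\<^esub>"
      using theta[of "\<one>\<^bsub>A\<^esub>"] by simp
  next
    fix x assume "x \<in> carrier (B\<lparr>carrier := commutator B\<rparr>)"
    then show "\<theta> x \<in> carrier (C\<lparr>carrier := commutator C\<rparr>)"
      by (auto simp: comm_B comm_C theta)
  next
    fix x y assume "x \<in> carrier (B\<lparr>carrier := commutator B\<rparr>)" "y \<in> carrier (B\<lparr>carrier := commutator B\<rparr>)"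
    then obtain x' y' where xy: "x' \<in> commutator A" "y' \<in> commutator A" "x = f x'" "y = f y'"
      by (auto simp: comm_B)
    note c = f.A.commutator_closed(2)[OF xy(1)] f.A.commutator_closed(2)[OF xy(2)]
    show "\<theta> (x \<otimes>\<^bsub>B\<lparr>carrier := commutator B\<rparr>\<^esub> y) = \<theta> x \<otimes>\<^bsub>C\<lparr>carrier := commutator C\<rparr>\<^esub> \<theta> y"
      using theta[OF f.A.commutator_circ_closed[OF xy(1,2)]] c by (simp add: xy theta)
    show "\<theta> (x \<oplus>\<^bsub>B\<lparr>carrier := commutator B\<rparr>\<^esub> y) = \<theta> x \<oplus>\<^bsub>C\<lparr>carrier := commutator C\<rparr>\<^esub> \<theta> y"
      using theta[OF f.A.commutator_closed(4)[OF xy(1,2)]] c by (simp add: xy theta)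
  qed
  moreover have "\<theta> (phi_add B S T) = phi_add C (\<xi> S) (\<xi> T) \<and> \<theta> (phi_star B S T) = phi_star C (\<xi> S) (\<xi> T)"
    if ST: "S \<in> carrier (B Quot annihilator B)" "T \<in> carrier (B Quot annihilator B)" for S T
  proof -
    obtain x y where xy: "x \<in> carrier A" "y \<in> carrier A" "S = ?cB x" "T = ?cB y"
      using ST unfolding carrier_B by blast
    have "\<theta> (add_commutator B (f x) (f y)) = add_commutator C (g x) (g y)"
      using theta[OF f.A.add_commutator_in_commutator] xy by (simp add: f.f_add_commutator g.f_add_commutator)
    moreover have "\<theta> (star B (f x) (f y)) = star C (g x) (g y)"
      using theta[OF f.A.star_in_commutator] xy by (simp add: f.f_star g.f_star)
    ultimately show ?thesis
      using xy by (simp add: xi f.B.phi_add_coset f.B.phi_star_coset g.B.phi_add_coset g.B.phi_star_coset)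
  qed
  ultimately show ?thesis
    unfolding isoclinic_def by blast
qed

section \<open>Transgression and Schur covers\<close>

text \<open>
  In other words, the inflation of \<open>(\<alpha>, \<mu>)\<close> along \<open>p\<close> is the coboundary of \<open>1 / u\<close>.
\<close>

definition trivializes ::
  "('e, 'm) ring_scheme \<Rightarrow> ('e \<Rightarrow> 'q) \<Rightarrow> ('q \<times> 'q \<Rightarrow> complex) \<Rightarrow> ('q \<times> 'q \<Rightarrow> complex) \<Rightarrow>
    ('e \<Rightarrow> complex) \<Rightarrow> bool" where
  "trivializes E p \<alpha> \<mu> u \<longleftrightarrow> u \<zero>\<^bsub>E\<^esub> = 1 \<and> (\<forall>a \<in> carrier E. u a \<noteq> 0) \<and>
     (\<forall>a \<in> carrier E. \<forall>b \<in> carrier E.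
        u (a \<oplus>\<^bsub>E\<^esub> b) = u a * u b * \<alpha> (p a, p b) \<and>
        u (a \<otimes>\<^bsub>E\<^esub> b) = u a * u b * \<mu> (p a, p b))"

lemma trivializesD:
  assumes "trivializes E p \<alpha> \<mu> u"
  shows "u \<zero>\<^bsub>E\<^esub> = 1" "a \<in> carrier E \<Longrightarrow> u a \<noteq> 0"
    "\<lbrakk>a \<in> carrier E; b \<in> carrier E\<rbrakk> \<Longrightarrow> u (a \<oplus>\<^bsub>E\<^esub> b) = u a * u b * \<alpha> (p a, p b)"
    "\<lbrakk>a \<in> carrier E; b \<in> carrier E\<rbrakk> \<Longrightarrow> u (a \<otimes>\<^bsub>E\<^esub> b) = u a * u b * \<mu> (p a, p b)"
  using assms by (auto simp: trivializes_def)

text \<open>The kernel of \<open>p\<close> takes the place of the abstract group \<open>K\<close>,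
  so the extension is described by \<open>p\<close> alone.\<close>

locale annihilator_ext = skew_brace_hom E Q p for E (structure) and Q (structure) and p +
  assumes surj: "p ` carrier E = carrier Q"
    and kernel_subset: "a_kernel E Q p \<subseteq> annihilator E"
begin

abbreviation ker :: "'a set" where
  "ker \<equiv> a_kernel E Q p"

abbreviation ker_group :: "'a monoid" where
  "ker_group \<equiv> \<lparr>carrier = ker, mult = (\<oplus>\<^bsub>E\<^esub>), one = \<zero>\<^bsub>E\<^esub>\<rparr>"

lemma mem_ker: "n \<in> ker \<longleftrightarrow> n \<in> carrier E \<and> p n = \<zero>\<^bsub>Q\<^esub>"
  by (simp add: a_kernel_def kernel_def)

lemma comm_group_ker: "comm_group ker_group"
proof (rule comm_groupI)
  fix x assume "x \<in> carrier ker_group"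
  then show "\<exists>y \<in> carrier ker_group. y \<otimes>\<^bsub>ker_group\<^esub> x = \<one>\<^bsub>ker_group\<^esub>"
    by (intro bexI[of _ "\<ominus>\<^bsub>E\<^esub> x"]) (auto simp: mem_ker)
next
  fix x y assume "x \<in> carrier ker_group" "y \<in> carrier ker_group"
  then show "x \<otimes>\<^bsub>ker_group\<^esub> y = y \<otimes>\<^bsub>ker_group\<^esub> x"
    using kernel_subset A.annihilatorD(2) by (auto simp: mem_ker)
qed (auto simp: mem_ker A.add.m_assoc)

text \<open>A set-theoretic section of \<open>p\<close>. It is normalized at zero so that
  \<open>lift\<close> restricts to the given character on the kernel.\<close>

definition transversal :: "'c \<Rightarrow> 'a" where
  "transversal x = (if x = \<zero>\<^bsub>Q\<^esub> then \<zero>\<^bsub>E\<^esub> else SOME a. a \<in> carrier E \<and> p a = x)"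

lemma transversal_zero [simp]: "transversal \<zero>\<^bsub>Q\<^esub> = \<zero>\<^bsub>E\<^esub>"
  by (simp add: transversal_def)

lemma transversal_mem [simp]:
  assumes "x \<in> carrier Q"
  shows "transversal x \<in> carrier E" "p (transversal x) = x"
proof -
  have "\<exists>a. a \<in> carrier E \<and> p a = x"
    using assms surj by (metis imageE)
  from someI_ex[OF this] have "transversal x \<in> carrier E \<and> p (transversal x) = x"
    unfolding transversal_def by (cases "x = \<zero>\<^bsub>Q\<^esub>") (simp_all only: simp_thms if_True if_False f_zero A.add.one_closed)
  then show "transversal x \<in> carrier E" "p (transversal x) = x"
    by simp_all
qed

definition ext_add :: "'c \<times> 'c \<Rightarrow> 'a" where
  "ext_add = (\<lambda>(x, y). transversal x \<oplus>\<^bsub>E\<^esub> transversal y \<ominus>\<^bsub>E\<^esub> transversal (x \<oplus>\<^bsub>Q\<^esub> y))"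

text \<open>With \<open>ext_add\<close>, this is the factor set of the extension. The additive
  difference serves for the circle operation too, since adding a kernel element is the same as
  circle multiplication by it.\<close>

definition ext_circ :: "'c \<times> 'c \<Rightarrow> 'a" where
  "ext_circ = (\<lambda>(x, y). transversal x \<otimes>\<^bsub>E\<^esub> transversal y \<ominus>\<^bsub>E\<^esub> transversal (x \<otimes>\<^bsub>Q\<^esub> y))"

text \<open>Every element of \<open>E\<close> is a kernel element plus its transversal
  representative, and \<chi> is evaluated at the kernel part. This extends \<chi> to a map on
  \<open>E\<close> that need not be a homomorphism.\<close>

definition lift :: "('a \<Rightarrow> complex) \<Rightarrow> 'a \<Rightarrow> complex" where
  "lift \<chi> a = \<chi> (a \<ominus>\<^bsub>E\<^esub> transversal (p a))"

lemma transversal_diff_mem_ker: "a \<in> carrier E \<Longrightarrow> a \<ominus>\<^bsub>E\<^esub> transversal (p a) \<in> ker"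
  by (simp add: mem_ker a_minus_def)

lemma ext_mem_ker:
  assumes "x \<in> carrier Q" "y \<in> carrier Q"
  shows "ext_add (x, y) \<in> ker" "ext_circ (x, y) \<in> ker"
  using transversal_diff_mem_ker[of "transversal x \<oplus>\<^bsub>E\<^esub> transversal y"]
    transversal_diff_mem_ker[of "transversal x \<otimes>\<^bsub>E\<^esub> transversal y"] assms
  by (simp_all add: ext_add_def ext_circ_def)

lemma lift_ker: "n \<in> ker \<Longrightarrow> lift \<chi> n = \<chi> n"
  by (simp add: lift_def mem_ker a_minus_def)

text \<open>Kernel elements move freely out of sums and circle products. The kernel parts of two
  elements therefore add up, corrected by \<open>ext_add\<close> or \<open>ext_circ\<close>, and
  \<chi> turns this sum into a product.\<close>

lemma trivializes_lift:
  assumes chi: "\<chi> \<in> hom ker_group complex_units"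
  shows "trivializes E p (\<chi> \<circ> ext_add) (\<chi> \<circ> ext_circ) (lift \<chi>)"
proof -
  have chi_nz: "\<chi> n \<noteq> 0" if "n \<in> ker" for n
    using chi that by (simp add: hom_complex_units_iff)
  have chi_mult: "\<chi> (n \<oplus>\<^bsub>E\<^esub> m) = \<chi> n * \<chi> m" if "n \<in> ker" "m \<in> ker" for n m
    using chi that by (simp add: hom_complex_units_iff)
  have ker_add: "n \<oplus>\<^bsub>E\<^esub> m \<in> ker" if "n \<in> ker" "m \<in> ker" for n m
    using that by (simp add: mem_ker)
  have "\<zero>\<^bsub>E\<^esub> \<in> ker"
    by (simp add: mem_ker)
  then have "lift \<chi> \<zero>\<^bsub>E\<^esub> = 1"
    using chi_mult[of "\<zero>\<^bsub>E\<^esub>" "\<zero>\<^bsub>E\<^esub>"] chi_nz[of "\<zero>\<^bsub>E\<^esub>"] by (simp add: lift_ker)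
  moreover have "lift \<chi> a \<noteq> 0" if "a \<in> carrier E" for a
    using chi_nz transversal_diff_mem_ker[OF that] by (simp add: lift_def)
  moreover have "lift \<chi> (a \<oplus>\<^bsub>E\<^esub> b) = lift \<chi> a * lift \<chi> b * \<chi> (ext_add (p a, p b)) \<and>
      lift \<chi> (a \<otimes>\<^bsub>E\<^esub> b) = lift \<chi> a * lift \<chi> b * \<chi> (ext_circ (p a, p b))"
    if a: "a \<in> carrier E" and b: "b \<in> carrier E" for a b
  proof -
    define n m where "n = a \<ominus>\<^bsub>E\<^esub> transversal (p a)" and "m = b \<ominus>\<^bsub>E\<^esub> transversal (p b)"
    have n: "n \<in> ker" and m: "m \<in> ker"
      using a b transversal_diff_mem_ker by (simp_all add: n_def m_def)
    note n' = A.annihilatorD[OF subsetD[OF kernel_subset n]]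
      and m' = A.annihilatorD[OF subsetD[OF kernel_subset m]]
    let ?s = "transversal (p a)" and ?t = "transversal (p b)"
    have st: "?s \<in> carrier E" "?t \<in> carrier E"
      using a b by simp_all
    have ab: "a = n \<oplus>\<^bsub>E\<^esub> ?s" "b = m \<oplus>\<^bsub>E\<^esub> ?t"
      using a b st by (simp_all add: n_def m_def a_minus_def A.add.m_assoc)
    have "a \<oplus>\<^bsub>E\<^esub> b = n \<oplus>\<^bsub>E\<^esub> ((?s \<oplus>\<^bsub>E\<^esub> m) \<oplus>\<^bsub>E\<^esub> ?t)"
      using n'(1) m'(1) st by (subst ab(1), subst ab(2)) (simp add: A.add.m_assoc)
    also have "\<dots> = n \<oplus>\<^bsub>E\<^esub> m \<oplus>\<^bsub>E\<^esub> (?s \<oplus>\<^bsub>E\<^esub> ?t)"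
      using n'(1) m'(1) st unfolding m'(2)[OF st(1), symmetric] by (simp add: A.add.m_assoc)
    finally have ab_add: "a \<oplus>\<^bsub>E\<^esub> b = n \<oplus>\<^bsub>E\<^esub> m \<oplus>\<^bsub>E\<^esub> (?s \<oplus>\<^bsub>E\<^esub> ?t)" .
    have "a \<oplus>\<^bsub>E\<^esub> b \<ominus>\<^bsub>E\<^esub> transversal (p (a \<oplus>\<^bsub>E\<^esub> b)) = n \<oplus>\<^bsub>E\<^esub> m \<oplus>\<^bsub>E\<^esub> ext_add (p a, p b)"
      unfolding f_add[OF a b] unfolding ab_add
      using n'(1) m'(1) a b by (simp add: ext_add_def a_minus_def A.add.m_assoc)
    moreover have "a \<otimes>\<^bsub>E\<^esub> b = (n \<otimes>\<^bsub>E\<^esub> ?s) \<otimes>\<^bsub>E\<^esub> (m \<otimes>\<^bsub>E\<^esub> ?t)"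
      using n'(4) m'(4) st ab by simp
    then have "a \<otimes>\<^bsub>E\<^esub> b = n \<otimes>\<^bsub>E\<^esub> (m \<otimes>\<^bsub>E\<^esub> (?s \<otimes>\<^bsub>E\<^esub> ?t))"
      using n'(1) m'(1) m'(3)[OF st(1)] st by (metis A.circ.m_assoc A.circ.m_closed)
    then have ab_circ: "a \<otimes>\<^bsub>E\<^esub> b = n \<oplus>\<^bsub>E\<^esub> m \<oplus>\<^bsub>E\<^esub> (?s \<otimes>\<^bsub>E\<^esub> ?t)"
      using n'(1,4) m'(1,4) st by (simp add: A.add.m_assoc)
    have "a \<otimes>\<^bsub>E\<^esub> b \<ominus>\<^bsub>E\<^esub> transversal (p (a \<otimes>\<^bsub>E\<^esub> b)) = n \<oplus>\<^bsub>E\<^esub> m \<oplus>\<^bsub>E\<^esub> ext_circ (p a, p b)"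
      unfolding f_circ[OF a b] unfolding ab_circ
      using n'(1) m'(1) a b by (simp add: ext_circ_def a_minus_def A.add.m_assoc)
    ultimately show ?thesis
      using a b n m ext_mem_ker[of "p a" "p b"]
      by (simp add: lift_def chi_mult ker_add flip: n_def m_def)
  qed
  ultimately show ?thesis
    by (simp add: trivializes_def)
qed

text \<open>The cocycle identities are the associativity laws and the brace law of \<open>E\<close>
  seen through \<open>u\<close>: the two sides of each law are evaluated and nonzero factors
  cancelled. Surjectivity of \<open>p\<close> covers all arguments in \<open>Q\<close>.\<close>

lemma trivializes_factor_set:
  assumes "trivializes E p \<alpha> \<mu> u"
  shows "factor_set Q complex_units \<alpha> \<mu>"
proof -
  note u = trivializesD[OF assms]
  have nz: "\<alpha> (p a, p b) \<noteq> 0 \<and> \<mu> (p a, p b) \<noteq> 0" if "a \<in> carrier E" "b \<in> carrier E" for a b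
    using that u(2)[of "a \<oplus>\<^bsub>E\<^esub> b"] u(2)[of "a \<otimes>\<^bsub>E\<^esub> b"] by (auto simp: u)
  have circ_zero: "\<zero>\<^bsub>E\<^esub> \<otimes>\<^bsub>E\<^esub> a = a" "a \<otimes>\<^bsub>E\<^esub> \<zero>\<^bsub>E\<^esub> = a" if "a \<in> carrier E" for a
    using that by (simp_all add: A.zero_eq_one)
  have unit: "\<alpha> (\<zero>\<^bsub>Q\<^esub>, p a) = 1 \<and> \<alpha> (p a, \<zero>\<^bsub>Q\<^esub>) = 1 \<and> \<mu> (\<zero>\<^bsub>Q\<^esub>, p a) = 1 \<and> \<mu> (p a, \<zero>\<^bsub>Q\<^esub>) = 1"
    if "a \<in> carrier E" for a
    using that u(1) u(2)[of a] u(3)[of "\<zero>\<^bsub>E\<^esub>" a] u(3)[of a "\<zero>\<^bsub>E\<^esub>"] u(4)[of "\<zero>\<^bsub>E\<^esub>" a] u(4)[of a "\<zero>\<^bsub>E\<^esub>"]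
    by (simp add: circ_zero)
  have assoc: "\<alpha> (p a, p b) * \<alpha> (p a \<oplus>\<^bsub>Q\<^esub> p b, p c) = \<alpha> (p b, p c) * \<alpha> (p a, p b \<oplus>\<^bsub>Q\<^esub> p c)"
    "\<mu> (p a, p b) * \<mu> (p a \<otimes>\<^bsub>Q\<^esub> p b, p c) = \<mu> (p b, p c) * \<mu> (p a, p b \<otimes>\<^bsub>Q\<^esub> p c)"
    if abc: "a \<in> carrier E" "b \<in> carrier E" "c \<in> carrier E" for a b c
  proof -
    have "u (a \<oplus>\<^bsub>E\<^esub> b \<oplus>\<^bsub>E\<^esub> c) = u (a \<oplus>\<^bsub>E\<^esub> (b \<oplus>\<^bsub>E\<^esub> c))"
      using abc by (simp add: A.add.m_assoc)
    then show "\<alpha> (p a, p b) * \<alpha> (p a \<oplus>\<^bsub>Q\<^esub> p b, p c) = \<alpha> (p b, p c) * \<alpha> (p a, p b \<oplus>\<^bsub>Q\<^esub> p c)"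
      using abc u(2)[of a] u(2)[of b] u(2)[of c] by (simp add: u(3))
    have "u (a \<otimes>\<^bsub>E\<^esub> b \<otimes>\<^bsub>E\<^esub> c) = u (a \<otimes>\<^bsub>E\<^esub> (b \<otimes>\<^bsub>E\<^esub> c))"
      using abc by (simp add: A.circ.m_assoc)
    then show "\<mu> (p a, p b) * \<mu> (p a \<otimes>\<^bsub>Q\<^esub> p b, p c) = \<mu> (p b, p c) * \<mu> (p a, p b \<otimes>\<^bsub>Q\<^esub> p c)"
      using abc u(2)[of a] u(2)[of b] u(2)[of c] by (simp add: u(4))
  qed
  have brace: "\<alpha> (p b, p c) * \<mu> (p a, p b \<oplus>\<^bsub>Q\<^esub> p c) * \<alpha> (\<ominus>\<^bsub>Q\<^esub> p a, p a) =
      \<mu> (p a, p c) * \<alpha> (p a \<otimes>\<^bsub>Q\<^esub> p b, \<ominus>\<^bsub>Q\<^esub> p a) *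
        \<alpha> ((p a \<otimes>\<^bsub>Q\<^esub> p b) \<ominus>\<^bsub>Q\<^esub> p a, p a \<otimes>\<^bsub>Q\<^esub> p c) * \<mu> (p a, p b)"
    if abc: "a \<in> carrier E" "b \<in> carrier E" "c \<in> carrier E" for a b c
  proof -
    have "u (a \<otimes>\<^bsub>E\<^esub> (b \<oplus>\<^bsub>E\<^esub> c)) = u ((a \<otimes>\<^bsub>E\<^esub> b) \<oplus>\<^bsub>E\<^esub> (\<ominus>\<^bsub>E\<^esub> a) \<oplus>\<^bsub>E\<^esub> (a \<otimes>\<^bsub>E\<^esub> c))"
      using abc by (simp add: A.circ_add a_minus_def)
    then have "\<alpha> (p b, p c) * \<mu> (p a, p b \<oplus>\<^bsub>Q\<^esub> p c) =
      u (\<ominus>\<^bsub>E\<^esub> a) * u a * (\<mu> (p a, p c) * \<alpha> (p a \<otimes>\<^bsub>Q\<^esub> p b, \<ominus>\<^bsub>Q\<^esub> p a) *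
        \<alpha> ((p a \<otimes>\<^bsub>Q\<^esub> p b) \<ominus>\<^bsub>Q\<^esub> p a, p a \<otimes>\<^bsub>Q\<^esub> p c) * \<mu> (p a, p b))"
      using abc u(2)[of a] u(2)[of b] u(2)[of c] by (simp add: u(3,4) a_minus_def mult_ac)
    \<comment> \<open>This relation, from \<open>u\<close> being 1 at zero, eliminates the value at
      the negative of \<open>a\<close> and produces the factor at \<open>(\<ominus> x, x)\<close> in
      the brace condition.\<close>
    moreover have "u (\<ominus>\<^bsub>E\<^esub> a) * u a * \<alpha> (\<ominus>\<^bsub>Q\<^esub> p a, p a) = 1"
      using abc u(1) u(3)[of "\<ominus>\<^bsub>E\<^esub> a" a] by simp
    moreover have "c * d = e" if "c = f * e" "f * d = 1" for c d e f :: complex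
      using that by (metis mult.assoc mult.commute mult.right_neutral)
    ultimately show ?thesis
      by blast
  qed
  show ?thesis
    unfolding B.factor_set_complex_units_iff using nz unit assoc brace by (auto simp flip: surj)
qed

text \<open>The coboundary is absorbed by multiplying \<open>u\<close> with the inflation of
  \<open>h\<close>. As \<open>h\<close> is 1 at zero, the values on the kernel do not
  change.\<close>

lemma trivializes_cohomologous:
  assumes "trivializes E p \<alpha> \<mu> u" "cohomologous Q \<alpha> \<mu> \<beta> \<nu>"
  obtains h where "h \<zero>\<^bsub>Q\<^esub> = 1" "trivializes E p \<beta> \<nu> (\<lambda>a. u a * h (p a))"
proof -
  note u = trivializesD[OF assms(1)]
  obtain h where h: "h \<zero>\<^bsub>Q\<^esub> = 1" "\<And>x. x \<in> carrier Q \<Longrightarrow> h x \<noteq> 0"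
    "\<And>x y. \<lbrakk>x \<in> carrier Q; y \<in> carrier Q\<rbrakk> \<Longrightarrow> \<alpha> (x, y) * h (x \<oplus>\<^bsub>Q\<^esub> y) = h x * h y * \<beta> (x, y)"
    "\<And>x y. \<lbrakk>x \<in> carrier Q; y \<in> carrier Q\<rbrakk> \<Longrightarrow> \<mu> (x, y) * h (x \<otimes>\<^bsub>Q\<^esub> y) = h x * h y * \<nu> (x, y)"
    using assms(2) by (rule cohomologousE) (rule that)
  have "trivializes E p \<beta> \<nu> (\<lambda>a. u a * h (p a))"
    unfolding trivializes_def
  proof (intro conjI ballI)
    fix a b assume ab: "a \<in> carrier E" "b \<in> carrier E"
    show "u (a \<oplus>\<^bsub>E\<^esub> b) * h (p (a \<oplus>\<^bsub>E\<^esub> b)) = u a * h (p a) * (u b * h (p b)) * \<beta> (p a, p b)"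
      using ab h(3)[of "p a" "p b"] by (simp add: u(3) mult_ac)
    show "u (a \<otimes>\<^bsub>E\<^esub> b) * h (p (a \<otimes>\<^bsub>E\<^esub> b)) = u a * h (p a) * (u b * h (p b)) * \<nu> (p a, p b)"
      using ab h(4)[of "p a" "p b"] by (simp add: u(4) mult_ac)
  qed (use h u in auto)
  then show thesis
    using h(1) that by blast
qed

text \<open>
  Transgression sends a character of the kernel to a class of factor sets; it is injective because a
  character with trivial image extends to all of \<open>E\<close> and so vanishes on the commutator. Counting
  makes it surjective.
\<close>

lemma exists_trivializes:
  assumes fin: "finite (carrier Q)" and comm: "ker \<subseteq> commutator E"
    and card: "card ker = card (carrier (schur_multiplier Q))"
    and fs: "factor_set Q complex_units \<alpha> \<mu>"
  obtains u where "trivializes E p \<alpha> \<mu> u"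
proof -
  let ?C = "carrier Q \<times> carrier Q"
  let ?cl = "\<lambda>c. B2b Q complex_units #>\<^bsub>Z2b Q complex_units\<^esub> c"
  \<comment> \<open>The transgression. Restriction provides the extensional representatives that
    \<open>Z2b\<close> asks for.\<close>
  define T where "T \<chi> = ?cl (restrict (\<chi> \<circ> ext_add) ?C, restrict (\<chi> \<circ> ext_circ) ?C)" for \<chi>
  interpret K: comm_group ker_group
    by (rule comm_group_ker)
  have class_mem: "?cl (restrict \<beta> ?C, restrict \<nu> ?C) \<in> carrier (schur_multiplier Q)"
    if "factor_set Q complex_units \<beta> \<nu>" for \<beta> \<nu>
    using that unfolding B.carrier_schur_multiplier
    by (intro imageI) (simp add: Z2b_def B.factor_set_complex_units_iff a_minus_def)
  have finM: "finite (carrier (schur_multiplier Q))"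
    by (rule B.finite_schur_multiplier[OF fin])
  have "finite ker"
    using card B.card_schur_multiplier_pos[OF fin] by (metis card_gt_0_iff)
  then obtain S where S: "S \<subseteq> hom ker_group complex_units \<inter> extensional ker" "finite S" "card ker \<le> card S"
    using K.order_le_card_characters unfolding order_def by auto
  have T_eq: "cohomologous Q (\<chi> \<circ> ext_add) (\<chi> \<circ> ext_circ) \<beta> \<nu>"
    if "T \<chi> = ?cl (restrict \<beta> ?C, restrict \<nu> ?C)" for \<chi> \<beta> \<nu>
  proof -
    have "cohomologous Q (restrict (\<chi> \<circ> ext_add) ?C) (restrict (\<chi> \<circ> ext_circ) ?C)
        (restrict \<beta> ?C) (restrict \<nu> ?C)"
      using that unfolding T_def by (subst (asm) B.B2b_coset_eq_iff) auto
    then show ?thesis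
      by (simp add: cohomologous_def)
  qed
  have "inj_on T S"
  proof (rule inj_onI)
    fix \<chi> \<psi> assume "\<chi> \<in> S" "\<psi> \<in> S" and eq: "T \<chi> = T \<psi>"
    then have chi: "\<chi> \<in> hom ker_group complex_units" "\<chi> \<in> extensional ker"
      and psi: "\<psi> \<in> hom ker_group complex_units" "\<psi> \<in> extensional ker"
      using S(1) by auto
    have "cohomologous Q (\<chi> \<circ> ext_add) (\<chi> \<circ> ext_circ) (\<psi> \<circ> ext_add) (\<psi> \<circ> ext_circ)"
      using eq by (intro T_eq) (simp add: T_def)
    then obtain h where h: "h \<zero>\<^bsub>Q\<^esub> = 1"
      and u: "trivializes E p (\<psi> \<circ> ext_add) (\<psi> \<circ> ext_circ) (\<lambda>a. lift \<chi> a * h (p a))"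
      using trivializes_cohomologous[OF trivializes_lift[OF chi(1)]] by blast
    note u' = trivializesD[OF u] and v' = trivializesD[OF trivializes_lift[OF psi(1)]]
    \<comment> \<open>Both sides trivialize the transgression of \<open>\<psi>\<close>, so they
      agree on the commutator, which contains the kernel.\<close>
    have eq_lift: "lift \<chi> n * h (p n) = lift \<psi> n" if "n \<in> ker" for n
      by (rule A.eq_on_commutator[OF u'(2-4) v'(2-4)]) (use that comm in auto)
    have "\<chi> n = \<psi> n" if "n \<in> ker" for n
      using eq_lift[OF that] h that lift_ker[OF that] by (simp add: mem_ker)
    then show "\<chi> = \<psi>"
      using chi psi by (intro extensionalityI)
  qed
  then have "card (T ` S) = card S"
    by (rule card_image)
  moreover have "T ` S \<subseteq> carrier (schur_multiplier Q)"
    using S(1) class_mem trivializes_factor_set trivializes_lift unfolding T_def by blast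
  \<comment> \<open>The image has at least \<open>card ker\<close> elements, and that is the size of
    the finite multiplier containing it.\<close>
  ultimately have "T ` S = carrier (schur_multiplier Q)"
    using finM S(3) card by (intro card_seteq) auto
  with class_mem[OF fs] have "?cl (restrict \<alpha> ?C, restrict \<mu> ?C) \<in> T ` S"
    by simp
  then obtain \<chi> where chi: "\<chi> \<in> S" "T \<chi> = ?cl (restrict \<alpha> ?C, restrict \<mu> ?C)"
    by (elim imageE) (rule that, simp_all)
  have "\<chi> \<in> hom ker_group complex_units"
    using chi(1) S(1) by blast
  then show thesis
    using trivializes_cohomologous[OF trivializes_lift T_eq[OF chi(2)]] that by metis
qed

end

text \<open>The element \<open>g x\<close> lies in the finite kernel of \<open>q\<close>; were it
  nonzero, a character \<chi> would detect it. The transgression of \<chi> is trivialized on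
  \<open>F\<close> by \<open>lift\<close> and on \<open>E\<close> by some \<open>u\<close>. Pulled
  back to \<open>A\<close> the two have equal defects, hence agree at \<open>x\<close>, so
  \<open>\<chi> (g x)\<close> is the value of \<open>u\<close> at zero, namely 1.\<close>

lemma (in skew_brace) transfer_zero:
  assumes fin: "finite (carrier Q)"
    and E: "annihilator_ext E Q p" "a_kernel E Q p \<subseteq> commutator E"
      "card (a_kernel E Q p) = card (carrier (schur_multiplier Q))"
    and F: "annihilator_ext F Q q" "finite (a_kernel F Q q)"
    and f: "skew_brace_hom A E f" and g: "skew_brace_hom A F g"
    and pq: "\<And>a. a \<in> carrier A \<Longrightarrow> p (f a) = q (g a)"
    and x: "x \<in> commutator A" "f x = \<zero>\<^bsub>E\<^esub>"
  shows "g x = \<zero>\<^bsub>F\<^esub>"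
proof (rule ccontr)
  assume neq: "g x \<noteq> \<zero>\<^bsub>F\<^esub>"
  interpret E: annihilator_ext E Q p by (rule E)
  interpret F: annihilator_ext F Q q by (rule F)
  interpret f: skew_brace_hom A E f by (rule f)
  interpret g: skew_brace_hom A F g by (rule g)
  interpret K: comm_group F.ker_group by (rule F.comm_group_ker)
  have gx: "g x \<in> F.ker"
    using x pq[of x] commutator_closed by (simp add: F.mem_ker)
  obtain \<chi> where chi: "\<chi> \<in> hom F.ker_group complex_units" "\<chi> (g x) \<noteq> 1"
    using K.exists_character_neq_1[of "g x"] F(2) gx neq by auto
  note v = F.trivializes_lift[OF chi(1)]
  obtain u where u: "trivializes E p (\<chi> \<circ> F.ext_add) (\<chi> \<circ> F.ext_circ) u"
    using E.exists_trivializes[OF fin E(2,3) F.trivializes_factor_set[OF v]] by blast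
  have "u (f x) = F.lift \<chi> (g x)"
    by (rule eq_on_commutator[where u = "\<lambda>a. u (f a)" and v = "\<lambda>a. F.lift \<chi> (g a)"
          and c = "\<lambda>a b. (\<chi> \<circ> F.ext_add) (q (g a), q (g b))"
          and d = "\<lambda>a b. (\<chi> \<circ> F.ext_circ) (q (g a), q (g b))", OF _ _ _ _ _ _ x(1)])
      (simp_all add: trivializesD[OF u] trivializesD[OF v] pq del: o_apply)
  then show False
    using chi(2) x(2) gx trivializesD(1)[OF u] by (simp add: F.lift_ker)
qed

section \<open>The fibre product of two covers and the isoclinism\<close>

definition fibre_product ::
  "('e, 'm) ring_scheme \<Rightarrow> ('e \<Rightarrow> 'q) \<Rightarrow> ('f, 'n) ring_scheme \<Rightarrow> ('f \<Rightarrow> 'q) \<Rightarrow> ('e \<times> 'f) ring" where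
  "fibre_product E p F q =
    \<lparr>carrier = {(a, b). a \<in> carrier E \<and> b \<in> carrier F \<and> p a = q b},
     mult = (\<lambda>(a, b) (c, d). (a \<otimes>\<^bsub>E\<^esub> c, b \<otimes>\<^bsub>F\<^esub> d)), one = (\<one>\<^bsub>E\<^esub>, \<one>\<^bsub>F\<^esub>),
     zero = (\<zero>\<^bsub>E\<^esub>, \<zero>\<^bsub>F\<^esub>), add = (\<lambda>(a, b) (c, d). (a \<oplus>\<^bsub>E\<^esub> c, b \<oplus>\<^bsub>F\<^esub> d))\<rparr>"

lemma skew_brace_fibre_product:
  assumes "skew_brace_hom E Q p" "skew_brace_hom F Q q"
  shows "skew_brace (fibre_product E p F q)"
proof -
  interpret p: skew_brace_hom E Q p by (rule assms)
  interpret q: skew_brace_hom F Q q by (rule assms)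
  let ?P = "fibre_product E p F q"
  have add_group: "group (add_monoid ?P)"
  proof (rule groupI)
    fix x assume "x \<in> carrier (add_monoid ?P)"
    then show "\<exists>y \<in> carrier (add_monoid ?P). y \<otimes>\<^bsub>add_monoid ?P\<^esub> x = \<one>\<^bsub>add_monoid ?P\<^esub>"
      by (intro bexI[of _ "(\<ominus>\<^bsub>E\<^esub> fst x, \<ominus>\<^bsub>F\<^esub> snd x)"]) (auto simp: fibre_product_def)
  qed (auto simp: fibre_product_def p.A.add.m_assoc q.A.add.m_assoc)
  have circ_group: "group ?P"
  proof (rule groupI)
    fix x assume "x \<in> carrier ?P"
    then show "\<exists>y \<in> carrier ?P. y \<otimes>\<^bsub>?P\<^esub> x = \<one>\<^bsub>?P\<^esub>"
      by (intro bexI[of _ "(inv\<^bsub>E\<^esub> fst x, inv\<^bsub>F\<^esub> snd x)"])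
        (auto simp: fibre_product_def p.f_circ_inv q.f_circ_inv)
  qed (auto simp: fibre_product_def p.A.circ.m_assoc q.A.circ.m_assoc)
  have minus: "\<ominus>\<^bsub>?P\<^esub> x = (\<ominus>\<^bsub>E\<^esub> fst x, \<ominus>\<^bsub>F\<^esub> snd x)" if "x \<in> carrier ?P" for x
    unfolding a_inv_def[of ?P]
    by (rule group.inv_equality[OF add_group]) (use that in \<open>auto simp: fibre_product_def\<close>)
  show ?thesis
  proof (rule skew_brace.intro[OF add_group circ_group])
    fix a b c assume "a \<in> carrier ?P" "b \<in> carrier ?P" "c \<in> carrier ?P"
    then show "a \<otimes>\<^bsub>?P\<^esub> (b \<oplus>\<^bsub>?P\<^esub> c) = ((a \<otimes>\<^bsub>?P\<^esub> b) \<ominus>\<^bsub>?P\<^esub> a) \<oplus>\<^bsub>?P\<^esub> (a \<otimes>\<^bsub>?P\<^esub> c)"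
      by (auto simp: a_minus_def[of ?P] minus)
        (auto simp: fibre_product_def p.A.circ_add q.A.circ_add a_minus_def)
  qed
qed

text \<open>The abstract group \<open>K\<close> is replaced by its image, the kernel of
  \<open>p\<close>. The isomorphism with the multiplier enters through cardinality, the datum on
  which the counting argument rests.\<close>

lemma schur_coverE:
  fixes E :: "('e, 'm) ring_scheme"
  assumes "schur_cover Q E"
  obtains p where "annihilator_ext E Q p" "a_kernel E Q p \<subseteq> commutator E"
    "card (a_kernel E Q p) = card (carrier (schur_multiplier Q))"
proof -
  obtain K :: "'e monoid" and i p where ext: "annihilator_extension K i E p Q"
    and comm: "i ` carrier K \<subseteq> commutator E" and iso: "K \<cong> schur_multiplier Q"
    using assms unfolding schur_cover_def by (elim exE conjE)
  have ker: "i ` carrier K = a_kernel E Q p" "inj_on i (carrier K)"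
    using ext by (simp_all only: annihilator_extension_def)
  have "annihilator_ext E Q p"
    using ext ker(1)
    by (simp only: annihilator_extension_def annihilator_ext_def annihilator_ext_axioms_def
        skew_brace_hom_def skew_brace_hom_axioms_def simp_thms)
  moreover have "card (a_kernel E Q p) = card (carrier (schur_multiplier Q))"
    using iso_same_card[OF iso] card_image[OF ker(2)] ker(1) by simp
  ultimately show thesis
    using that comm ker(1) by simp
qed

theorem theorem3p19:
  fixes Q :: "('q, 'm) ring_scheme"
    and E :: "('e, 'k) ring_scheme"
    and F :: "('f, 'l) ring_scheme"
  assumes "skew_brace Q" and "finite (carrier Q)"
    and "schur_cover Q E" and "schur_cover Q F"
  shows "isoclinic E F"
proof -
  obtain p where E: "annihilator_ext E Q p" "a_kernel E Q p \<subseteq> commutator E"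
    "card (a_kernel E Q p) = card (carrier (schur_multiplier Q))"
    using assms(3) by (rule schur_coverE)
  obtain q where F: "annihilator_ext F Q q" "a_kernel F Q q \<subseteq> commutator F"
    "card (a_kernel F Q q) = card (carrier (schur_multiplier Q))"
    using assms(4) by (rule schur_coverE)
  interpret Q: skew_brace Q by (rule assms)
  interpret E: annihilator_ext E Q p by (rule E)
  interpret F: annihilator_ext F Q q by (rule F)
  have fin: "finite E.ker" "finite F.ker"
    using E(3) F(3) Q.card_schur_multiplier_pos[OF assms(2)] by (metis card_gt_0_iff)+
  let ?P = "fibre_product E p F q"
  interpret P: skew_brace ?P
    by (rule skew_brace_fibre_product) unfold_locales
  have f: "skew_brace_hom ?P E fst" and g: "skew_brace_hom ?P F snd"
    by (unfold_locales, auto simp: ring_hom_def fibre_product_def)+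
  have pq: "p (fst a) = q (snd a)" if "a \<in> carrier ?P" for a
    using that by (auto simp: fibre_product_def)
  have "fst ` carrier ?P = carrier E"
  proof -
    have "\<exists>b \<in> carrier F. p a = q b" if "a \<in> carrier E" for a
      using that E.f_closed F.surj by (metis imageE)
    then show ?thesis
      by (force simp: fibre_product_def)
  qed
  moreover have "snd ` carrier ?P = carrier F"
  proof -
    have "\<exists>a \<in> carrier E. p a = q b" if "b \<in> carrier F" for b
      using that F.f_closed E.surj by (metis imageE)
    then show ?thesis
      by (force simp: fibre_product_def)
  qed
  \<comment> \<open>An element of the commutator with zero first component has zero second component
    by transfer from \<open>E\<close> to \<open>F\<close>. Exchanging the covers gives injectivity
    of the other projection.\<close>
  moreover have "inj_on fst (commutator ?P)"
    using P.transfer_zero[OF assms(2) E F(1) fin(2) f g pq]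
    by (intro skew_brace_hom.inj_on_commutatorI[OF f]) (auto simp: fibre_product_def prod_eq_iff)
  moreover have "inj_on snd (commutator ?P)"
    using P.transfer_zero[OF assms(2) F E(1) fin(1) g f pq[symmetric]]
    by (intro skew_brace_hom.inj_on_commutatorI[OF g]) (auto simp: fibre_product_def prod_eq_iff)
  ultimately show ?thesis
    using isoclinic_of_common_cover[OF f _ _ g] by blast
qed

end
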